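(* Let $V$ be a real Hilbert space, $p\ge1$, and let $\mathbb X,\mathbb Y$ be geometric $p$-rough paths in $V$ over $[0,T]$. Let $n\ge\lfloor p\rfloor$, $[s,s'],[t,t']\subseteq[0,T]$, $\mathbb A,\mathbb B\in E$, and write $\log_nS(\mathbb X)_{s,s'}=(x^0,x^1,\dots,x^n)$ and $\log_nS(\mathbb Y)_{t,t'}=(y^0,y^1,\dots,y^n)$ with $x^k,y^k\in V^{\otimes k}$ (so $x^0=y^0=0$). Let $\mathbb Z^x,\mathbb Z^y:[0,1]\to E$ be the solutions of the step-$n$ log-ODEs $$\frac{d\mathbb Z^x_u}{du}=\mathbb Z^x_u\cdot\log_nS(\mathbb X)_{s,s'},\ \mathbb Z^x_0=\mathbb A,\qquad \frac{d\mathbb Z^y_v}{dv}=\mathbb Z^y_v\cdot\log_nS(\mathbb Y)_{t,t'},\ \mathbb Z^y_0=\mathbb B .$$ For $(u,v)\in[0,1]^2$ set $f_{u,v}=\langle\mathbb Z^x_u,\mathbb Z^y_v\rangle$, $\varphi^0_{u,v}=\psi^0_{u,v}=0$, and for $k=1,\dots,n-1$ $$\varphi^k_{u,v}=\pi_k\big(L^*_{\mathbb Z^x_u}(\mathbb Z^y_v)\big),\qquad \psi^k_{u,v}=\pi_k\big(L^*_{\mathbb Z^y_v}(\mathbb Z^x_u)\big)\in V^{\otimes k}.$$ Then for all $(u,v)\in[0,1]\times[0,1]$ and all $k=1,\dots,n-1$ $$\frac{\partial^2f}{\partial u\,\partial v}=\gamma f+\sum_{k=0}^{n-1}\langle\alpha^k,\varphi^k\rangle_k+\sum_{k=0}^{n-1}\langle\beta^k,\psi^k\rangle_k,$$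 $$\frac{\partial\varphi^k}{\partial v}=y^kf+\sum_{m=0}^k\varphi^m\otimes y^{k-m}+\sum_{m=0}^{n-k}L^*_{\psi^m}(y^{k+m}),$$ $$\frac{\partial\psi^k}{\partial u}=x^kf+\sum_{m=0}^k\psi^m\otimes x^{k-m}+\sum_{m=0}^{n-k}L^*_{\varphi^m}(x^{k+m}),$$ with boundary conditions $$f_{0,v}=\langle\mathbb A,\mathbb Z^y_v\rangle,\quad \psi^k_{0,v}=\pi_k(L^*_{\mathbb Z^y_v}(\mathbb A)),\quad \varphi^k_{0,v}=\pi_k(L^*_{\mathbb A}(\mathbb Z^y_v)),$$ $$f_{u,0}=\langle\mathbb Z^x_u,\mathbb B\rangle,\quad \varphi^k_{u,0}=\pi_k(L^*_{\mathbb Z^x_u}(\mathbb B)),\quad \psi^k_{u,0}=\pi_k(L^*_{\mathbb B}(\mathbb Z^x_u)),$$ where $$\alpha^k=\sum_{m=1}^{n-k}R^*_{y^m}(x^{m+k}),\qquad \beta^k=\sum_{m=1}^{n-k}R^*_{x^m}(y^{m+k}),\qquad \gamma=\sum_{k=1}^n\langle x^k,y^k\rangle_k .$$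
   Context: $T((V))=\prod_{k\ge0}V^{\otimes k}$ with product $(\mathbb A\cdot\mathbb B)^n=\sum_{k=0}^na^k\otimes b^{n-k}$ and unit $\mathbb 1=(1,0,0,\dots)$; $\pi_k$ is the projection onto $V^{\otimes k}$, and elements of $V^{\otimes k}$ are regarded as elements of $T((V))$ concentrated in degree $k$. Each $V^{\otimes k}$ carries the Hilbert–Schmidt inner product $\langle\cdot,\cdot\rangle_k$, and $\langle\mathbb A,\mathbb B\rangle=\sum_k\langle a^k,b^k\rangle_k$. $E=\{\mathbb A\in T((V)):\sum_k\|a^k\|_{V^{\otimes k}}<\infty\}$, a Banach algebra. Adjoints of tensor multiplication (identifying $V$ with $V^*$): $L^*_{\mathbb A}$ and $R^*_{\mathbb A}$ are the adjoints of $\mathbb C\mapsto\mathbb A\cdot\mathbb C$ and $\mathbb C\mapsto\mathbb C\cdot\mathbb A$, i.e. $L^*_{\mathbb A}(\mathbb B)$ and $R^*_{\mathbb A}(\mathbb B)$ are the tensor series determined by $\langle L^*_{\mathbb A}(\mathbb B),c\rangle=\langle\mathbb B,\mathbb A\cdot c\rangle$ and $\langle R^*_{\mathbb A}(\mathbb B),c\rangle=\langle\mathbb B,c\cdot\mathbb A\rangle$ for all $c$ with finitely many nonzero components (well defined for $\mathbb A,\mathbb B\in E$). On orthonormal basis words, $L^*$ by a word deletes it as a prefix and $R^*$ by a word deletes it as a suffix, giving $0$ if this is impossible. A $p$-rough path over $[0,T]$ is a continuous map $\mathbb X:\{0\le s\le t\le T\}\to\bigoplus_{k=0}^{\lfloor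 p\rfloor}V^{\otimes k}$ with degree-$0$ component $1$, satisfying Chen's identity $\mathbb X_{s,u}\cdot\mathbb X_{u,t}=\mathbb X_{s,t}$ (in the truncated algebra) and of finite $p$-variation; it is geometric if it is a limit in $p$-variation of truncated signatures of continuous bounded variation paths. $S(\mathbb X)_{s,t}\in T((V))$ is its signature: the unique extension to a $T((V))$-valued multiplicative functional of finite $p$-variation. For $a^0=0$, $\log(\mathbb 1+\mathbb A)=\sum_{k\ge1}\frac{(-1)^{k-1}}k\mathbb A^{\cdot k}$; $\log_nS(\mathbb X)_{s,t}$ is the projection of $\log S(\mathbb X)_{s,t}$ onto degrees $\le n$. *)

theory Defs
  imports "HOL-Analysis.Analysis"
begin

section \<open>Orthonormal bases\<close>

definition orthonormal_basis :: "'a::{real_inner,banach} set \<Rightarrow> bool" where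
  "orthonormal_basis S \<longleftrightarrow>
     pairwise orthogonal S \<and> (\<forall>e\<in>S. norm e = 1) \<and> closure (span S) = UNIV"

lemma orthogonal_complement_vector:
  fixes S :: "'a::{real_inner,banach} set"
  assumes "closure (span S) \<noteq> UNIV"
  obtains e where "norm e = 1" "\<And>z. z \<in> S \<Longrightarrow> inner e z = 0"
proof -
  let ?M = "span S"
  from assms obtain x where x: "x \<notin> closure ?M" by auto
  define d where "d = infdist x ?M"
  have ne: "?M \<noteq> {}" using span_zero by blast
  have dle: "d \<le> norm (x - z)" if "z \<in> ?M" for z
    using infdist_le[OF that, of x] by (simp add: d_def dist_norm)
  have d0: "d \<ge> 0" by (simp add: d_def infdist_nonneg)
  have "\<exists>z\<in>?M. norm (x - z) < d + 1 / real (Suc n)" for n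
  proof -
    have "infdist x ?M < d + 1 / real (Suc n)" by (simp add: d_def)
    then have "(INF a\<in>?M. dist x a) < d + 1 / real (Suc n)"
      using ne by (simp add: infdist_def)
    then show ?thesis
      using cInf_lessD[of "dist x ` ?M" "d + 1 / real (Suc n)"] ne by (auto simp: dist_norm)
  qed
  then obtain y where yM: "\<And>n. y n \<in> ?M" and yd: "\<And>n. norm (x - y n) < d + 1 / real (Suc n)"
    by metis
  have par: "(norm (y m - y n))\<^sup>2 \<le> 2 * (norm (x - y m))\<^sup>2 + 2 * (norm (x - y n))\<^sup>2 - 4 * d\<^sup>2" for m n
  proof -
    let ?a = "x - y m" and ?b = "x - y n"
    have "(1/2) *\<^sub>R (y m + y n) \<in> ?M" using yM by (intro span_scale span_add) auto
    then have "d \<le> norm (x - (1/2) *\<^sub>R (y m + y n))" by (rule dle)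
    also have "x - (1/2) *\<^sub>R (y m + y n) = (1/2) *\<^sub>R (?a + ?b)"
      by (simp add: algebra_simps flip: scaleR_add_left)
    also have "norm \<dots> = norm (?a + ?b) / 2" by simp
    finally have "2 * d \<le> norm (?a + ?b)" by simp
    then have "(2 * d)\<^sup>2 \<le> (norm (?a + ?b))\<^sup>2" using d0 by (intro power_mono) auto
    moreover have "(norm (?a + ?b))\<^sup>2 + (norm (?a - ?b))\<^sup>2 = 2 * (norm ?a)\<^sup>2 + 2 * (norm ?b)\<^sup>2"
      by (simp add: power2_norm_eq_inner inner_add_left inner_add_right inner_diff_left inner_diff_right)
    moreover have "norm (?a - ?b) = norm (y m - y n)" by (simp add: norm_minus_commute)
    ultimately show ?thesis by (simp add: power_mult_distrib)
  qed
  have lim1: "(\<lambda>n. norm (x - y n)) \<longlonglongrightarrow> d"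
  proof (rule tendsto_sandwich[of "\<lambda>_. d" _ _ "\<lambda>n. d + 1 / real (Suc n)"])
    show "(\<lambda>n. d + 1 / real (Suc n)) \<longlonglongrightarrow> d"
      using tendsto_add[OF tendsto_const[of d] LIMSEQ_Suc[OF lim_1_over_n]] by simp
  qed (use yd dle yM in \<open>auto intro!: always_eventually less_imp_le\<close>)
  have "Cauchy y"
  proof (rule metric_CauchyI)
    fix e :: real assume e: "e > 0"
    have "(\<lambda>n. 2 * (norm (x - y n))\<^sup>2) \<longlonglongrightarrow> 2 * d\<^sup>2" by (intro tendsto_intros lim1)
    then obtain N where N: "\<And>n. n \<ge> N \<Longrightarrow> dist (2 * (norm (x - y n))\<^sup>2) (2 * d\<^sup>2) < e\<^sup>2 / 2"
      using metric_LIMSEQ_D[of _ _ "e\<^sup>2 / 2"] e by (metis half_gt_zero zero_less_power)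
    show "\<exists>M. \<forall>m\<ge>M. \<forall>n\<ge>M. dist (y m) (y n) < e"
    proof (intro exI allI impI)
      fix m n assume "m \<ge> N" "n \<ge> N"
      then have "(norm (y m - y n))\<^sup>2 < e\<^sup>2"
        using par[of m n] N[of m] N[of n] unfolding dist_real_def abs_less_iff by linarith
      then show "dist (y m) (y n) < e" using e by (simp add: dist_norm power_less_imp_less_base)
    qed
  qed
  then obtain l where l: "y \<longlonglongrightarrow> l" using Cauchy_convergent convergent_def by blast
  have lM: "l \<in> closure ?M" using l yM closure_sequential by blast
  have nl: "norm (x - l) = d"
    using tendsto_norm[OF tendsto_diff[OF tendsto_const[of x] l]] lim1 LIMSEQ_unique by blast
  define r where "r = x - l"
  have r0: "r \<noteq> 0" using x lM by (auto simp: r_def)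
  have rz: "inner r z = 0" if "z \<in> S" for z
  proof (cases "z = 0")
    case False
    define c where "c = inner r z / (norm z)\<^sup>2"
    have "(\<lambda>n. norm (x - (y n + c *\<^sub>R z))) \<longlonglongrightarrow> norm (x - (l + c *\<^sub>R z))"
      by (intro tendsto_intros l)
    moreover have "d \<le> norm (x - (y n + c *\<^sub>R z))" for n
      by (rule dle, rule span_add[OF yM span_scale[OF span_base[OF that]]])
    ultimately have "d \<le> norm (x - (l + c *\<^sub>R z))" by (simp add: LIMSEQ_le_const)
    also have "x - (l + c *\<^sub>R z) = r - c *\<^sub>R z" by (simp add: r_def)
    finally have "(norm r)\<^sup>2 \<le> (norm (r - c *\<^sub>R z))\<^sup>2" using nl d0 by (simp add: r_def power_mono)
    also have "\<dots> = (norm r)\<^sup>2 - 2 * c * inner r z + c\<^sup>2 * (norm z)\<^sup>2"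
      by (simp add: power2_norm_eq_inner inner_diff_left inner_diff_right inner_commute[of z r]
          algebra_simps) (simp add: power2_eq_square algebra_simps)
    also have "\<dots> = (norm r)\<^sup>2 - (inner r z)\<^sup>2 / (norm z)\<^sup>2"
      using False by (simp add: c_def field_simps power2_eq_square)
    finally have "(inner r z)\<^sup>2 / (norm z)\<^sup>2 \<le> 0" by simp
    then show ?thesis using False by (simp add: divide_le_0_iff)
  qed auto
  show thesis
  proof (rule that[of "r /\<^sub>R norm r"])
    show "norm (r /\<^sub>R norm r) = 1" using r0 by simp
  qed (use rz in auto)
qed

lemma orthonormal_basis_exists: "\<exists>S::'a::{real_inner,banach} set. orthonormal_basis S"
proof -
  let ?A = "{S::'a set. pairwise orthogonal S \<and> (\<forall>e\<in>S. norm e = 1)}"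
  have "\<exists>M\<in>?A. \<forall>X\<in>?A. M \<subseteq> X \<longrightarrow> X = M"
  proof (rule subset_Zorn')
    fix C assume C: "subset.chain ?A C"
    then have sub: "C \<subseteq> ?A" and tot: "\<And>X Y. X \<in> C \<Longrightarrow> Y \<in> C \<Longrightarrow> X \<subseteq> Y \<or> Y \<subseteq> X"
      by (auto simp: subset_chain_def)
    have "pairwise orthogonal (\<Union>C)"
      unfolding pairwise_def
    proof (intro ballI impI)
      fix a b assume "a \<in> \<Union>C" "b \<in> \<Union>C" "a \<noteq> b"
      then obtain X Y where "a \<in> X" "X \<in> C" "b \<in> Y" "Y \<in> C" by blast
      moreover from this tot have "X \<subseteq> Y \<or> Y \<subseteq> X" by blast
      ultimately obtain Z where "Z \<in> C" "a \<in> Z" "b \<in> Z" by blast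
      then show "orthogonal a b" using sub \<open>a \<noteq> b\<close> by (auto simp: pairwise_def)
    qed
    then show "\<Union>C \<in> ?A" using sub by auto
  qed
  then obtain M where M: "M \<in> ?A" and mx: "\<forall>X\<in>?A. M \<subseteq> X \<longrightarrow> X = M" by (rule bexE)
  have "closure (span M) = UNIV"
  proof (rule ccontr)
    assume "closure (span M) \<noteq> UNIV"
    from orthogonal_complement_vector[OF this]
    have "\<exists>e. norm e = 1 \<and> (\<forall>z\<in>M. inner e z = 0)" by metis
    then obtain e where e: "norm e = 1" "\<forall>z\<in>M. inner e z = 0" by blast
    have "e \<notin> M"
    proof
      assume "e \<in> M"
      then have "inner e e = 0" using e(2) by blast
      then show False using e(1) by simp
    qed
    moreover have "insert e M \<in> ?A"
      using M e by (simp add: pairwise_insert orthogonal_def inner_commute[of _ e])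
    ultimately show False using mx by blast
  qed
  then show ?thesis using M by (auto simp: orthonormal_basis_def)
qed

text \<open>One orthonormal basis is selected to write the Hilbert--Schmidt inner products as sums
  over basis words; by Parseval in each slot these inner products do not depend on the selection.\<close>

definition onb :: "'a::{real_inner,banach} set" where
  "onb = (SOME S. orthonormal_basis S)"

lemma orthonormal_basis_onb: "orthonormal_basis onb"
  unfolding onb_def by (rule someI_ex[OF orthonormal_basis_exists])

definition onb_words :: "nat \<Rightarrow> 'a::{real_inner,banach} list set" where
  "onb_words k = {w. length w = k \<and> set w \<subseteq> onb}"

lemma bessel_onb:
  fixes v :: "'a::{real_inner,banach}"
  shows "(\<lambda>e. (inner v e)\<^sup>2) summable_on onb"
proof (rule nonneg_bdd_above_summable_on)
  show "bdd_above (sum (\<lambda>e. (inner v e)\<^sup>2) ` {F. F \<subseteq> onb \<and> finite F})"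
  proof (rule bdd_aboveI2[where M = "inner v v"])
    fix F assume "F \<in> {F. F \<subseteq> (onb :: 'a set) \<and> finite F}"
    then have F: "F \<subseteq> onb" "finite F" by auto
    have on: "inner e e' = (if e = e' then 1 else 0)" if "e \<in> F" "e' \<in> F" for e e'
      using orthonormal_basis_onb F that
      by (auto simp: orthonormal_basis_def pairwise_def orthogonal_def norm_eq_1 subset_iff)
    let ?q = "\<Sum>e\<in>F. inner v e *\<^sub>R e"
    let ?r = "v - ?q"
    have q1: "inner v ?q = (\<Sum>e\<in>F. (inner v e)\<^sup>2)"
      by (simp add: inner_sum_right power2_eq_square)
    have "(\<Sum>e'\<in>F. inner v e' * inner e' e) = inner v e" if e: "e \<in> F" for e
    proof -
      have "(\<Sum>e'\<in>F. inner v e' * inner e' e) = (\<Sum>e'\<in>F. if e' = e then inner v e' else 0)"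
        by (intro sum.cong refl) (simp add: on e)
      then show ?thesis using e F by simp
    qed
    then have q2: "inner ?q ?q = (\<Sum>e\<in>F. (inner v e)\<^sup>2)"
      by (simp add: inner_sum_left inner_sum_right power2_eq_square)
    have "0 \<le> inner ?r ?r" by (rule inner_ge_zero)
    moreover have "inner ?r ?r = inner v v - 2 * inner v ?q + inner ?q ?q"
      by (simp only: inner_diff_left inner_diff_right inner_commute[of ?q v])
    ultimately show "(\<Sum>e\<in>F. (inner v e)\<^sup>2) \<le> inner v v"
      unfolding q1 q2 by linarith
  qed
qed simp


section \<open>The algebra of tensor series\<close>

text \<open>Identifying the Hilbert space \<open>V\<close> with its dual, the (completed) tensor power of order
  \<open>k\<close> is the space of Hilbert--Schmidt \<open>k\<close>-linear forms on \<open>V\<close>: the tensor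
  \<open>a\<^sub>1 \<otimes> \<dots> \<otimes> a\<^sub>k\<close> is the form sending \<open>v\<^sub>1, \<dots>, v\<^sub>k\<close> to the product of the
  \<open>inner a\<^sub>i v\<^sub>i\<close>. A tensor series is a function on lists whose restriction to the lists of
  length \<open>k\<close> is its component of degree \<open>k\<close>.\<close>

definition hs_forms :: "('a::{real_inner,banach} list \<Rightarrow> real) set" where
  "hs_forms = {F.
     (\<forall>u w. linear (\<lambda>v. F (u @ v # w))) \<and>
     (\<forall>k. \<exists>C. \<forall>w. length w = k \<longrightarrow> \<bar>F w\<bar> \<le> C * prod_list (map norm w)) \<and>
     (\<forall>k. (\<lambda>w. (F w)\<^sup>2) summable_on onb_words k)}"

lemma hs_formsI:
  assumes "\<And>u w. linear (\<lambda>v. F (u @ v # w))"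
    and "\<And>k. \<exists>C. \<forall>w. length w = k \<longrightarrow> \<bar>F w\<bar> \<le> C * prod_list (map norm w)"
    and "\<And>k. (\<lambda>w. (F w)\<^sup>2) summable_on onb_words k"
  shows "F \<in> hs_forms"
  using assms by (simp add: hs_forms_def)

lemma hs_formsD:
  assumes "F \<in> hs_forms"
  shows "linear (\<lambda>v. F (u @ v # w))"
    and "\<exists>C. \<forall>w. length w = k \<longrightarrow> \<bar>F w\<bar> \<le> C * prod_list (map norm w)"
    and "(\<lambda>w. (F w)\<^sup>2) summable_on onb_words k"
  using assms by (simp_all add: hs_forms_def)

lemma prod_list_norm_nonneg: "0 \<le> prod_list (map norm (w :: 'a::real_normed_vector list))"
  by (induction w) auto

lemma hs_forms_glue:
  assumes "\<And>k. \<exists>G\<in>hs_forms. \<forall>w. length w = k \<longrightarrow> F w = G w"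
  shows "F \<in> hs_forms"
proof -
  from assms obtain G where G: "\<And>k. G k \<in> hs_forms"
    and FG: "\<And>k w. length w = k \<Longrightarrow> F w = G k w" by metis
  show ?thesis
  proof (rule hs_formsI)
    fix u w :: "'a list"
    have "(\<lambda>v. F (u @ v # w)) = (\<lambda>v. G (length u + length w + 1) (u @ v # w))"
      by (intro ext FG) simp
    then show "linear (\<lambda>v. F (u @ v # w))" using hs_formsD(1)[OF G] by simp
  next
    fix k show "\<exists>C. \<forall>w. length w = k \<longrightarrow> \<bar>F w\<bar> \<le> C * prod_list (map norm w)"
      using hs_formsD(2)[OF G[of k], of k] FG by metis
  next
    fix k
    show "(\<lambda>w. (F w)\<^sup>2) summable_on onb_words k"
      using hs_formsD(3)[OF G[of k], of k]
      by (rule summable_on_cong[THEN iffD1, rotated]) (simp add: FG onb_words_def)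
  qed
qed

lemma hs_forms_zero: "(\<lambda>_. 0) \<in> hs_forms"
  by (rule hs_formsI) (auto intro: exI[of _ 0] simp: linear_zero)

lemma hs_forms_scale:
  assumes "F \<in> hs_forms" shows "(\<lambda>w. c * F w) \<in> hs_forms"
proof (rule hs_formsI)
  fix u w show "linear (\<lambda>v. c * F (u @ v # w))"
    using linear_compose_scale_right[OF hs_formsD(1)[OF assms, of u w], of c] by simp
next
  fix k obtain C where C: "\<And>w. length w = k \<Longrightarrow> \<bar>F w\<bar> \<le> C * prod_list (map norm w)"
    using hs_formsD(2)[OF assms] by blast
  have "\<bar>c * F w\<bar> \<le> (\<bar>c\<bar> * C) * prod_list (map norm w)" if "length w = k" for w
    using mult_left_mono[OF C[OF that], of "\<bar>c\<bar>"] by (simp add: abs_mult ac_simps)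
  then show "\<exists>C. \<forall>w. length w = k \<longrightarrow> \<bar>c * F w\<bar> \<le> C * prod_list (map norm w)" by blast
next
  fix k show "(\<lambda>w. (c * F w)\<^sup>2) summable_on onb_words k"
    using summable_on_cmult_right[OF hs_formsD(3)[OF assms]] by (simp add: power_mult_distrib)
qed

lemma hs_forms_add:
  assumes "F \<in> hs_forms" "G \<in> hs_forms" shows "(\<lambda>w. F w + G w) \<in> hs_forms"
proof (rule hs_formsI)
  fix u w show "linear (\<lambda>v. F (u @ v # w) + G (u @ v # w))"
    by (intro linear_compose_add hs_formsD assms)
next
  fix k
  obtain C where C: "\<And>w. length w = k \<Longrightarrow> \<bar>F w\<bar> \<le> C * prod_list (map norm w)"
    using hs_formsD(2)[OF assms(1)] by blast
  obtain D where D: "\<And>w. length w = k \<Longrightarrow> \<bar>G w\<bar> \<le> D * prod_list (map norm w)"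
    using hs_formsD(2)[OF assms(2)] by blast
  have "\<bar>F w + G w\<bar> \<le> (C + D) * prod_list (map norm w)" if "length w = k" for w
    using C[OF that] D[OF that] abs_triangle_ineq[of "F w" "G w"] by (simp add: distrib_right)
  then show "\<exists>C. \<forall>w. length w = k \<longrightarrow> \<bar>F w + G w\<bar> \<le> C * prod_list (map norm w)" by blast
next
  fix k
  have "(\<lambda>w. 2 * (F w)\<^sup>2 + 2 * (G w)\<^sup>2) summable_on onb_words k"
    by (intro summable_on_add summable_on_cmult_right hs_formsD assms)
  then show "(\<lambda>w. (F w + G w)\<^sup>2) summable_on onb_words k"
  proof (rule summable_on_comparison_test)
    show "(F w + G w)\<^sup>2 \<le> 2 * (F w)\<^sup>2 + 2 * (G w)\<^sup>2" for w
      using zero_le_power2[of "F w - G w"] by (simp add: power2_eq_square algebra_simps)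
  qed auto
qed

lemma hs_forms_sum:
  "(\<And>i. i \<in> I \<Longrightarrow> F i \<in> hs_forms) \<Longrightarrow> (\<lambda>w. \<Sum>i\<in>I. F i w) \<in> hs_forms"
  by (induction I rule: infinite_finite_induct) (auto intro: hs_forms_zero hs_forms_add)

lemma hs_forms_tproj:
  assumes "F \<in> hs_forms" shows "(\<lambda>w. if length w = k then F w else 0) \<in> hs_forms"
proof (rule hs_forms_glue)
  fix j show "\<exists>G\<in>hs_forms. \<forall>w. length w = j \<longrightarrow> (if length w = k then F w else 0) = G w"
    using assms hs_forms_zero by (cases "j = k") auto
qed

lemma hs_forms_one: "(\<lambda>w :: 'a::{real_inner,banach} list. if w = [] then 1 else 0) \<in> hs_forms"
proof (rule hs_formsI)
  fix k :: nat
  have *: "onb_words 0 = {[] :: 'a list}" by (auto simp: onb_words_def)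
  have **: "(\<lambda>w :: 'a list. (if w = [] then 1 else 0)\<^sup>2 :: real) summable_on onb_words k \<longleftrightarrow>
      (\<lambda>w :: 'a list. 0 :: real) summable_on onb_words k" if "k \<noteq> 0"
    using that by (intro summable_on_cong) (auto simp: onb_words_def)
  show "(\<lambda>w :: 'a list. (if w = [] then 1 else 0)\<^sup>2 :: real) summable_on onb_words k"
    using * ** by (cases "k = 0") auto
  show "\<exists>C. \<forall>w. length w = k \<longrightarrow> \<bar>if w = [] then 1 else 0\<bar> \<le> C * prod_list (map norm (w :: 'a list))"
    by (rule exI[of _ 1]) (auto intro: prod_list_norm_nonneg)
qed (simp add: linear_zero)

lemma hs_forms_embed:
  fixes v :: "'a::{real_inner,banach}"
  shows "(\<lambda>w. case w of [u] \<Rightarrow> inner v u | _ \<Rightarrow> 0) \<in> hs_forms"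
  (is "?F \<in> _")
proof (rule hs_formsI)
  fix u w :: "'a list"
  have "(\<lambda>x. ?F (u @ x # w)) = (if u = [] \<and> w = [] then (\<lambda>x. inner v x) else (\<lambda>x. 0))"
    by (auto simp: fun_eq_iff split: list.splits) (auto simp: append_eq_Cons_conv Cons_eq_append_conv)
  then show "linear (\<lambda>x. ?F (u @ x # w))"
    by (auto simp: linear_zero bounded_linear.linear[OF bounded_linear_inner_right])
next
  fix k
  show "\<exists>C. \<forall>w. length w = k \<longrightarrow> \<bar>?F w\<bar> \<le> C * prod_list (map norm w)"
    by (rule exI[of _ "norm v"])
      (auto split: list.splits simp: Cauchy_Schwarz_ineq2 prod_list_norm_nonneg)
next
  fix k
  show "(\<lambda>w. (?F w)\<^sup>2) summable_on onb_words k"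
  proof (cases "k = 1")
    case True
    have "onb_words 1 = (\<lambda>e. [e]) ` onb" by (auto simp: onb_words_def length_Suc_conv)
    moreover have "(\<lambda>w. (?F w)\<^sup>2) summable_on (\<lambda>e. [e]) ` onb"
      by (subst summable_on_reindex) (auto simp: inj_on_def o_def bessel_onb)
    ultimately show ?thesis using True by metis
  next
    case False
    have "(\<lambda>w. (?F w)\<^sup>2) summable_on onb_words k \<longleftrightarrow> (\<lambda>w :: 'a list. 0 :: real) summable_on onb_words k"
      using False by (intro summable_on_cong) (auto simp: onb_words_def split: list.splits)
    then show ?thesis by simp
  qed
qed

lemma summable_on_onb_words_split:
  fixes F G :: "'a::{real_inner,banach} list \<Rightarrow> real"
  assumes F: "F \<in> hs_forms" and G: "G \<in> hs_forms" and i: "i \<le> k"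
  shows "(\<lambda>w. (F (take i w) * G (drop i w))\<^sup>2) summable_on onb_words k"
proof -
  have "(\<lambda>(x, y). (F x)\<^sup>2 * (G y)\<^sup>2) summable_on onb_words i \<times> onb_words (k - i)"
  proof (rule summable_on_SigmaI)
    fix x
    show "((\<lambda>y. case (x, y) of (x, y) \<Rightarrow> (F x)\<^sup>2 * (G y)\<^sup>2) has_sum
        (F x)\<^sup>2 * (\<Sum>\<^sub>\<infinity>y\<in>onb_words (k - i). (G y)\<^sup>2)) (onb_words (k - i))"
      using has_sum_cmult_right[OF has_sum_infsum[OF hs_formsD(3)[OF G]]] by simp
  next
    show "(\<lambda>x. (F x)\<^sup>2 * (\<Sum>\<^sub>\<infinity>y\<in>onb_words (k - i). (G y)\<^sup>2)) summable_on onb_words i"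
      by (intro summable_on_cmult_left hs_formsD F)
  qed auto
  moreover have "bij_betw (\<lambda>w. (take i w, drop i w)) (onb_words k) (onb_words i \<times> onb_words (k - i))"
    by (rule bij_betwI[where g = "\<lambda>(x, y). x @ y"])
      (use i in \<open>auto simp: onb_words_def dest: in_set_takeD in_set_dropD\<close>)
  ultimately have "(\<lambda>w. case (take i w, drop i w) of (x, y) \<Rightarrow> (F x)\<^sup>2 * (G y)\<^sup>2) summable_on onb_words k"
    by (subst summable_on_reindex_bij_betw)
  then show ?thesis by (simp add: power_mult_distrib)
qed

lemma hs_forms_mult:
  fixes F G :: "'a::{real_inner,banach} list \<Rightarrow> real"
  assumes F: "F \<in> hs_forms" and G: "G \<in> hs_forms"
  shows "(\<lambda>w. \<Sum>i\<le>length w. F (take i w) * G (drop i w)) \<in> hs_forms"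
proof (rule hs_forms_glue)
  fix k
  have "(\<lambda>w. if length w = k then F (take i w) * G (drop i w) else 0) \<in> hs_forms" (is "?H \<in> _")
    if i: "i \<le> k" for i
  proof (rule hs_formsI)
    fix u w :: "'a list"
    show "linear (\<lambda>v. ?H (u @ v # w))"
    proof (cases "length (u @ undefined # w) = k")
      case True
      show ?thesis
      proof (cases "i \<le> length u")
        case ule: True
        then have "(\<lambda>v. ?H (u @ v # w)) = (\<lambda>v. F (take i u) *\<^sub>R G (drop i u @ v # w))"
          using True by auto
        then show ?thesis using linear_compose_scale_right[OF hs_formsD(1)[OF G]] by simp
      next
        case False
        then obtain j where j: "i = length u + Suc j" using less_iff_Suc_add by (metis add_Suc_right not_le_imp_less)
        then have "(\<lambda>v. ?H (u @ v # w)) = (\<lambda>v. G (drop j w) *\<^sub>R F (u @ v # take j w))"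
          using True by (auto simp: ac_simps)
        then show ?thesis using linear_compose_scale_right[OF hs_formsD(1)[OF F]] by simp
      qed
    qed (auto simp: linear_zero)
  next
    fix m
    obtain C where C: "\<And>w. length w = i \<Longrightarrow> \<bar>F w\<bar> \<le> C * prod_list (map norm w)"
      using hs_formsD(2)[OF F] by blast
    obtain D where D: "\<And>w. length w = k - i \<Longrightarrow> \<bar>G w\<bar> \<le> D * prod_list (map norm w)"
      using hs_formsD(2)[OF G] by blast
    have bd: "\<bar>?H w\<bar> \<le> (C * D) * prod_list (map norm w)" if "length w = k" for w
    proof -
      have l: "length (take i w) = i" "length (drop i w) = k - i" using that i by auto
      have "0 \<le> C * prod_list (map norm (take i w))" using C[OF l(1)] by linarith
      then have "\<bar>F (take i w) * G (drop i w)\<bar>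
          \<le> (C * prod_list (map norm (take i w))) * (D * prod_list (map norm (drop i w)))"
        unfolding abs_mult using C[OF l(1)] D[OF l(2)] by (intro mult_mono) auto
      also have "\<dots> = (C * D) * (prod_list (map norm (take i w)) * prod_list (map norm (drop i w)))"
        by simp
      also have "prod_list (map norm (take i w)) * prod_list (map norm (drop i w))
          = prod_list (map norm w)"
        by (metis append_take_drop_id map_append prod_list.append)
      finally show ?thesis using that by simp
    qed
    show "\<exists>C. \<forall>w. length w = m \<longrightarrow> \<bar>?H w\<bar> \<le> C * prod_list (map norm w)"
      using bd by (cases "m = k") (auto intro: exI[of _ 0])
  next
    fix m
    show "(\<lambda>w. (?H w)\<^sup>2) summable_on onb_words m"
    proof (cases "m = k")
      case True
      have "(\<lambda>w. (?H w)\<^sup>2) summable_on onb_words k \<longleftrightarrow>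
          (\<lambda>w. (F (take i w) * G (drop i w))\<^sup>2) summable_on onb_words k"
        by (intro summable_on_cong) (auto simp: onb_words_def)
      then show ?thesis using summable_on_onb_words_split[OF F G i] True by simp
    next
      case False
      then have "(\<lambda>w. (?H w)\<^sup>2) summable_on onb_words m \<longleftrightarrow> (\<lambda>w :: 'a list. 0 :: real) summable_on onb_words m"
        by (intro summable_on_cong) (auto simp: onb_words_def)
      then show ?thesis by simp
    qed
  qed
  then have "(\<lambda>w. \<Sum>i\<le>k. if length w = k then F (take i w) * G (drop i w) else 0) \<in> hs_forms"
    by (intro hs_forms_sum) auto
  then show "\<exists>H\<in>hs_forms. \<forall>w. length w = k \<longrightarrow>
      (\<Sum>i\<le>length w. F (take i w) * G (drop i w)) = H w"
    by (rule bexI[rotated]) auto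
qed

typedef (overloaded) 'a tensor_series = "hs_forms :: ('a::{real_inner,banach} list \<Rightarrow> real) set"
  morphisms teval Abs_tensor_series
  using hs_forms_zero by blast

setup_lifting type_definition_tensor_series

lemma tensor_series_eqI: "(\<And>w. teval A w = teval B w) \<Longrightarrow> A = B"
  by (simp add: teval_inject[symmetric] fun_eq_iff)

instantiation tensor_series :: ("{real_inner,banach}") real_vector
begin

lift_definition zero_tensor_series :: "'a tensor_series" is "\<lambda>_. 0"
  by (rule hs_forms_zero)

lift_definition plus_tensor_series :: "'a tensor_series \<Rightarrow> 'a tensor_series \<Rightarrow> 'a tensor_series"
  is "\<lambda>F G w. F w + G w"
  by (rule hs_forms_add)

lift_definition uminus_tensor_series :: "'a tensor_series \<Rightarrow> 'a tensor_series"
  is "\<lambda>F w. - F w"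
  using hs_forms_scale[of _ "-1"] by simp

lift_definition minus_tensor_series :: "'a tensor_series \<Rightarrow> 'a tensor_series \<Rightarrow> 'a tensor_series"
  is "\<lambda>F G w. F w - G w"
  using hs_forms_add[OF _ hs_forms_scale[of _ "-1"]] by simp

lift_definition scaleR_tensor_series :: "real \<Rightarrow> 'a tensor_series \<Rightarrow> 'a tensor_series"
  is "\<lambda>c F w. c * F w"
  by (rule hs_forms_scale)

instance
  by standard (transfer; simp add: fun_eq_iff algebra_simps)+

end

text \<open>Evaluation of \<open>a\<^sup>k \<otimes> b\<^sup>n\<^sup>-\<^sup>k\<close> at a list \<open>w\<close> of length \<open>n\<close> multiplies the
  values of the two factors at the first \<open>k\<close> and at the remaining entries of \<open>w\<close>.\<close>

instantiation tensor_series :: ("{real_inner,banach}") real_algebra_1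
begin

lift_definition one_tensor_series :: "'a tensor_series" is "\<lambda>w. if w = [] then 1 else 0"
  by (rule hs_forms_one)

lift_definition times_tensor_series :: "'a tensor_series \<Rightarrow> 'a tensor_series \<Rightarrow> 'a tensor_series"
  is "\<lambda>F G w. \<Sum>k\<le>length w. F (take k w) * G (drop k w)"
  by (rule hs_forms_mult)

instance
proof
  fix A B C :: "'a tensor_series" and c :: real
  show "A * B * C = A * (B * C)"
  proof (transfer, rule ext)
    fix F G H :: "'a list \<Rightarrow> real" and w :: "'a list"
    let ?n = "length w"
    have "(\<Sum>k\<le>length w. (\<Sum>j\<le>length (take k w). F (take j (take k w)) * G (drop j (take k w))) * H (drop k w))
        = (\<Sum>k\<le>?n. \<Sum>j\<le>k. F (take j w) * G (take (k - j) (drop j w)) * H (drop k w))"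
      by (intro sum.cong refl) (auto simp: sum_distrib_right min_def drop_take)
    also have "\<dots> = (\<Sum>(k, j)\<in>(SIGMA k:{..?n}. {..k}).
        F (take j w) * G (take (k - j) (drop j w)) * H (drop k w))"
      by (simp add: sum.Sigma)
    also have "\<dots> = (\<Sum>(j, i)\<in>(SIGMA j:{..?n}. {..?n - j}).
        F (take j w) * G (take i (drop j w)) * H (drop i (drop j w)))"
      by (rule sum.reindex_bij_witness[where i = "\<lambda>(j, i). (i + j, j)" and j = "\<lambda>(k, j). (j, k - j)"])
        auto
    also have "\<dots> = (\<Sum>j\<le>?n. \<Sum>i\<le>?n - j. F (take j w) * G (take i (drop j w)) * H (drop i (drop j w)))"
      by (simp add: sum.Sigma)
    also have "\<dots> = (\<Sum>j\<le>?n. F (take j w) *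
        (\<Sum>i\<le>length (drop j w). G (take i (drop j w)) * H (drop i (drop j w))))"
      by (simp add: sum_distrib_left mult.assoc)
    finally show "(\<Sum>k\<le>length w. (\<Sum>j\<le>length (take k w). F (take j (take k w)) * G (drop j (take k w))) * H (drop k w))
        = (\<Sum>j\<le>?n. F (take j w) * (\<Sum>i\<le>length (drop j w). G (take i (drop j w)) * H (drop i (drop j w))))" .
  qed
  show "1 * A = A"
  proof (transfer, rule ext)
    fix F :: "'a list \<Rightarrow> real" and w :: "'a list"
    have "(\<Sum>k\<le>length w. (if take k w = [] then 1 else 0) * F (drop k w)) =
        (\<Sum>k\<le>length w. if k = 0 then F w else 0)" by (intro sum.cong refl) auto
    then show "(\<Sum>k\<le>length w. (if take k w = [] then 1 else 0) * F (drop k w)) = F w" by simp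
  qed
  show "A * 1 = A"
  proof (transfer, rule ext)
    fix F :: "'a list \<Rightarrow> real" and w :: "'a list"
    have "(\<Sum>k\<le>length w. F (take k w) * (if drop k w = [] then 1 else 0)) =
        (\<Sum>k\<le>length w. if k = length w then F w else 0)" by (intro sum.cong refl) auto
    then show "(\<Sum>k\<le>length w. F (take k w) * (if drop k w = [] then 1 else 0)) = F w" by simp
  qed
  show "(A + B) * C = A * C + B * C" "A * (B + C) = A * B + A * C"
    by (transfer, simp add: fun_eq_iff algebra_simps sum.distrib)+
  show "c *\<^sub>R A * B = c *\<^sub>R (A * B)" "A * c *\<^sub>R B = c *\<^sub>R (A * B)"
    by (transfer, simp add: fun_eq_iff sum_distrib_left ac_simps)+
  show "(0::'a tensor_series) \<noteq> 1"
    by transfer (auto simp: fun_eq_iff)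
qed

end

text \<open>Elements of the \<open>k\<close>-th tensor power are regarded as series concentrated in degree
  \<open>k\<close>, so \<open>tproj\<close> is both the component map and its composition with the inclusion.\<close>

lift_definition tproj :: "nat \<Rightarrow> 'a::{real_inner,banach} tensor_series \<Rightarrow> 'a tensor_series"
  is "\<lambda>k F w. if length w = k then F w else 0"
  by (rule hs_forms_tproj)

definition ttrunc :: "nat \<Rightarrow> 'a::{real_inner,banach} tensor_series \<Rightarrow> 'a tensor_series" where
  "ttrunc n A = (\<Sum>k\<le>n. tproj k A)"

lift_definition tvec :: "'a::{real_inner,banach} \<Rightarrow> 'a tensor_series"
  is "\<lambda>v w. case w of [u] \<Rightarrow> inner v u | _ \<Rightarrow> 0"
  by (rule hs_forms_embed)

definition hs_inner ::
    "nat \<Rightarrow> 'a::{real_inner,banach} tensor_series \<Rightarrow> 'a tensor_series \<Rightarrow> real" where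
  "hs_inner k A B = (\<Sum>\<^sub>\<infinity>w\<in>onb_words k. teval A w * teval B w)"

definition hs_norm :: "nat \<Rightarrow> 'a::{real_inner,banach} tensor_series \<Rightarrow> real" where
  "hs_norm k A = sqrt (hs_inner k A A)"

definition tinner :: "'a::{real_inner,banach} tensor_series \<Rightarrow> 'a tensor_series \<Rightarrow> real" where
  "tinner A B = (\<Sum>k. hs_inner k A B)"

definition E_space :: "'a::{real_inner,banach} tensor_series set" where
  "E_space = {A. summable (\<lambda>k. hs_norm k A)}"

definition E_norm :: "'a::{real_inner,banach} tensor_series \<Rightarrow> real" where
  "E_norm A = (\<Sum>k. hs_norm k A)"

definition finite_degree :: "'a::{real_inner,banach} tensor_series \<Rightarrow> bool" where
  "finite_degree c \<longleftrightarrow> finite {k. tproj k c \<noteq> 0}"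

definition Ladj :: "'a::{real_inner,banach} tensor_series \<Rightarrow> 'a tensor_series \<Rightarrow> 'a tensor_series" where
  "Ladj A B = (THE D. \<forall>c. finite_degree c \<longrightarrow> tinner D c = tinner B (A * c))"

definition Radj :: "'a::{real_inner,banach} tensor_series \<Rightarrow> 'a tensor_series \<Rightarrow> 'a tensor_series" where
  "Radj A B = (THE D. \<forall>c. finite_degree c \<longrightarrow> tinner D c = tinner B (c * A))"

text \<open>For \<open>S\<close> with scalar component \<open>1\<close> the \<open>k\<close>-th power of \<open>S - 1\<close> has no component
  in degrees below \<open>k\<close>, so at a list of length \<open>j\<close> the logarithmic series stops at
  \<open>k = j\<close>.\<close>

lift_definition tlog :: "'a::{real_inner,banach} tensor_series \<Rightarrow> 'a tensor_series"
  is "\<lambda>S w. \<Sum>k = 1..length w. (-1) ^ (k - 1) / real k * teval ((S - 1) ^ k) w"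
proof -
  fix S :: "'a tensor_series"
  let ?f = "\<lambda>k w. (-1) ^ (k - 1) / real k * teval ((S - 1) ^ k) w"
  show "(\<lambda>w. \<Sum>k = 1..length w. ?f k w) \<in> hs_forms"
  proof (rule hs_forms_glue)
    fix j
    have "(\<lambda>w. \<Sum>k = 1..j. ?f k w) \<in> hs_forms"
      by (intro hs_forms_sum hs_forms_scale teval)
    then show "\<exists>G\<in>hs_forms. \<forall>w. length w = j \<longrightarrow> (\<Sum>k = 1..length w. ?f k w) = G w"
      by (rule bexI[rotated]) auto
  qed
qed

text \<open>One-sided at the end points of the unit interval. On series concentrated in degree
  \<open>k\<close> the norm of \<open>E\<close> is the Hilbert--Schmidt norm, so this is also the derivative of paths in
  the \<open>k\<close>-th tensor power.\<close>

definition has_E_derivative ::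
    "(real \<Rightarrow> 'a::{real_inner,banach} tensor_series) \<Rightarrow> 'a tensor_series \<Rightarrow> real \<Rightarrow> bool" where
  "has_E_derivative Z D u \<longleftrightarrow>
     ((\<lambda>w. E_norm ((Z w - Z u) /\<^sub>R (w - u) - D)) \<longlongrightarrow> 0) (at u within {0..1})"


section \<open>Rough paths and signatures\<close>

definition simplex2 :: "real \<Rightarrow> (real \<times> real) set" where
  "simplex2 T = {(s, t). 0 \<le> s \<and> s \<le> t \<and> t \<le> T}"

definition dissection :: "real \<Rightarrow> real \<Rightarrow> nat \<Rightarrow> (nat \<Rightarrow> real) \<Rightarrow> bool" where
  "dissection a b n \<tau> \<longleftrightarrow> \<tau> 0 = a \<and> \<tau> n = b \<and> (\<forall>i<n. \<tau> i \<le> \<tau> (Suc i))"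

definition variation :: "real \<Rightarrow> real \<Rightarrow> (real \<Rightarrow> real \<Rightarrow> real) \<Rightarrow> ennreal" where
  "variation q T N =
     (SUP (n, \<tau>) \<in> {(n, \<tau>). dissection 0 T n \<tau>}. ennreal (\<Sum>i<n. N (\<tau> i) (\<tau> (Suc i)) powr q))"

text \<open>The component of degree \<open>k\<close> is measured in \<open>p / k\<close>-variation.\<close>

definition pvar ::
    "real \<Rightarrow> real \<Rightarrow> nat \<Rightarrow> (real \<Rightarrow> real \<Rightarrow> 'a::{real_inner,banach} tensor_series) \<Rightarrow> ennreal" where
  "pvar p T k X = variation (p / real k) T (\<lambda>s t. hs_norm k (X s t))"

definition continuous_component ::
    "real \<Rightarrow> nat \<Rightarrow> (real \<Rightarrow> real \<Rightarrow> 'a::{real_inner,banach} tensor_series) \<Rightarrow> bool" where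
  "continuous_component T k X \<longleftrightarrow>
     (\<forall>(s, t)\<in>simplex2 T.
        ((\<lambda>(s', t'). hs_norm k (X s' t' - X s t)) \<longlongrightarrow> 0) (at (s, t) within simplex2 T))"

definition rough_path ::
    "real \<Rightarrow> real \<Rightarrow> (real \<Rightarrow> real \<Rightarrow> 'a::{real_inner,banach} tensor_series) \<Rightarrow> bool" where
  "rough_path p T X \<longleftrightarrow>
     (\<forall>(s, t)\<in>simplex2 T. ttrunc (nat \<lfloor>p\<rfloor>) (X s t) = X s t \<and> tproj 0 (X s t) = 1) \<and>
     (\<forall>s u t. 0 \<le> s \<and> s \<le> u \<and> u \<le> t \<and> t \<le> T \<longrightarrow>
        ttrunc (nat \<lfloor>p\<rfloor>) (X s u * X u t) = X s t) \<and>
     (\<forall>k. continuous_component T k X) \<and>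
     (\<forall>k\<in>{1..nat \<lfloor>p\<rfloor>}. pvar p T k X < \<infinity>)"

definition signature_of ::
    "real \<Rightarrow> real \<Rightarrow> (real \<Rightarrow> real \<Rightarrow> 'a::{real_inner,banach} tensor_series) \<Rightarrow>
     (real \<Rightarrow> real \<Rightarrow> 'a tensor_series) \<Rightarrow> bool" where
  "signature_of p T X S \<longleftrightarrow>
     (\<forall>(s, t)\<in>simplex2 T. ttrunc (nat \<lfloor>p\<rfloor>) (S s t) = X s t \<and> tproj 0 (S s t) = 1) \<and>
     (\<forall>s u t. 0 \<le> s \<and> s \<le> u \<and> u \<le> t \<and> t \<le> T \<longrightarrow> S s u * S u t = S s t) \<and>
     (\<forall>k. continuous_component T k S) \<and>
     (\<forall>k\<ge>1. pvar p T k S < \<infinity>)"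

text \<open>Riemann--Stieltjes integral of a tensor-valued function against a path in \<open>V\<close>, the
  increment being multiplied on the right.\<close>

definition has_RS_integral ::
    "(real \<Rightarrow> 'a::{real_inner,banach} tensor_series) \<Rightarrow> (real \<Rightarrow> 'a) \<Rightarrow> real \<Rightarrow> real \<Rightarrow>
     'a tensor_series \<Rightarrow> bool" where
  "has_RS_integral Y x s t I \<longleftrightarrow>
     (\<forall>\<epsilon>>0. \<exists>\<delta>>0. \<forall>n \<tau> \<xi>.
        dissection s t n \<tau> \<and>
        (\<forall>i<n. \<tau> i \<le> \<xi> i \<and> \<xi> i \<le> \<tau> (Suc i) \<and> \<tau> (Suc i) - \<tau> i < \<delta>) \<longrightarrow>
        E_norm ((\<Sum>i<n. Y (\<xi> i) * tvec (x (\<tau> (Suc i)) - x (\<tau> i))) - I) < \<epsilon>)"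

text \<open>The signature of a path of bounded variation, as iterated integrals.\<close>

definition path_signature ::
    "real \<Rightarrow> (real \<Rightarrow> 'a::{real_inner,banach}) \<Rightarrow> (real \<Rightarrow> real \<Rightarrow> 'a tensor_series) \<Rightarrow> bool" where
  "path_signature T x S \<longleftrightarrow>
     (\<forall>(s, t)\<in>simplex2 T. tproj 0 (S s t) = 1 \<and>
        (\<forall>k. has_RS_integral (\<lambda>u. tproj k (S s u)) x s t (tproj (Suc k) (S s t))))"

definition bv_path :: "real \<Rightarrow> (real \<Rightarrow> 'a::{real_inner,banach}) \<Rightarrow> bool" where
  "bv_path T x \<longleftrightarrow> continuous_on {0..T} x \<and> variation 1 T (\<lambda>s t. norm (x t - x s)) < \<infinity>"

text \<open>All components of \<open>X\<close> above degree \<open>\<lfloor>p\<rfloor>\<close> vanish, so truncating the signatures of the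
  approximating paths only restricts the degrees in which convergence is required.\<close>

definition geometric_rough_path ::
    "real \<Rightarrow> real \<Rightarrow> (real \<Rightarrow> real \<Rightarrow> 'a::{real_inner,banach} tensor_series) \<Rightarrow> bool" where
  "geometric_rough_path p T X \<longleftrightarrow> rough_path p T X \<and>
     (\<exists>x S. (\<forall>m::nat. bv_path T (x m) \<and> path_signature T (x m) (S m)) \<and>
        (\<forall>k\<in>{1..nat \<lfloor>p\<rfloor>}. (\<lambda>m. pvar p T k (\<lambda>s t. ttrunc (nat \<lfloor>p\<rfloor>) (S m s t) - X s t)) \<longlonglongrightarrow> 0))"


section \<open>The log-ODE\<close>

definition logn ::
    "nat \<Rightarrow> 'a::{real_inner,banach} tensor_series \<Rightarrow> 'a tensor_series" where
  "logn n S = ttrunc n (tlog S)"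

definition solves_log_ode ::
    "(real \<Rightarrow> 'a::{real_inner,banach} tensor_series) \<Rightarrow> 'a tensor_series \<Rightarrow> 'a tensor_series \<Rightarrow> bool" where
  "solves_log_ode Z A x \<longleftrightarrow>
     Z 0 = A \<and> (\<forall>u\<in>{0..1}. Z u \<in> E_space \<and> has_E_derivative Z (Z u * x) u)"

end

theory Submission
  imports Defs
begin

text \<open>The rough paths enter only through the finite-degree generators
  \<open>x = x\<^sup>1 + \<dots> + x\<^sup>n\<close> and \<open>y = y\<^sup>1 + \<dots> + y\<^sup>n\<close> of the two log-ODEs. Since the inner product and the
  adjoints are bounded on \<open>E\<close>, differentiation in \<open>v\<close> replaces \<open>Z\<^sup>y\<close> by \<open>Z\<^sup>y \<cdot> y\<close>, and in \<open>u\<close> it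
  replaces \<open>Z\<^sup>x\<close> by \<open>Z\<^sup>x \<cdot> x\<close>. All equations then come from one identity:
  \<open>\<langle>P \<cdot> b, Q \<cdot> c\<rangle> = \<langle>P, Q \<cdot> R\<^sup>*\<^sub>b c\<rangle> = \<langle>L\<^sup>*\<^sub>Q P, R\<^sup>*\<^sub>b c\<rangle>\<close> for homogeneous \<open>b\<close>, \<open>c\<close> with
  \<open>deg b \<le> deg c\<close>.\<close>

text \<open>Before this identity can be used, the adjoints must be shown to exist.
  \<open>Ladj\<close> and \<open>Radj\<close> are definite descriptions, and a tensor series is a
  form on all of V, so coefficients on basis words alone do not yet make a series. Uniqueness rests
  on \<open>tproj_eq_zeroI\<close>, which spreads vanishing on basis words to all arguments by
  density of \<open>span onb\<close>; existence rests on \<open>riesz_tensor_series\<close>, which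
  represents a functional by its values on elementary tensors. The degree condition dictates how the
  equations split. In the mixed derivative the shorter of two generator pieces is stripped from the
  longer one: equal degrees give \<gamma>, a longer piece of x gives \<alpha>, a longer piece of y
  gives \<beta>. In the first-order equations a piece y^j is compared with the degree k projected
  onto: for j \<le> k it survives whole behind a component of \<phi>, for j > k part of it is
  deleted by a component of \<psi>. The scalar component of either adjoint is f; as \<phi>^0 and
  \<psi>^0 are set to 0, that contribution appears as a term of its own.\<close>

lemma teval_add [simp]: "teval (A + B) w = teval A w + teval B w"
  by transfer simp

lemma teval_diff [simp]: "teval (A - B) w = teval A w - teval B w"
  by transfer simp

lemma teval_zero [simp]: "teval 0 w = 0"
  by transfer simp

lemma teval_scaleR [simp]: "teval (c *\<^sub>R A) w = c * teval A w"
  by transfer simp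

lemma teval_one: "teval 1 w = (if w = [] then 1 else 0)"
  by transfer simp

lemma teval_sum [simp]: "teval (\<Sum>i\<in>I. A i) w = (\<Sum>i\<in>I. teval (A i) w)"
  by (induction I rule: infinite_finite_induct) auto

lemma teval_tproj: "teval (tproj k A) w = (if length w = k then teval A w else 0)"
  by transfer simp

lemma teval_mult: "teval (A * B) w = (\<Sum>k\<le>length w. teval A (take k w) * teval B (drop k w))"
  by transfer simp

lemma teval_tvec: "teval (tvec v) w = (case w of [u] \<Rightarrow> inner v u | _ \<Rightarrow> 0)"
  by transfer simp

lemma tproj_tproj [simp]: "tproj k (tproj j A) = (if j = k then tproj k A else 0)"
  by (rule tensor_series_eqI) (auto simp: teval_tproj)

lemma tproj_zero [simp]: "tproj k 0 = 0"
  by (rule tensor_series_eqI) (simp add: teval_tproj)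

lemma tproj_one: "tproj 0 1 = 1"
  by (rule tensor_series_eqI) (simp add: teval_tproj teval_one)

lemma tproj_add: "tproj k (A + B) = tproj k A + tproj k B"
  by (rule tensor_series_eqI) (simp add: teval_tproj)

lemma tproj_diff: "tproj k (A - B) = tproj k A - tproj k B"
  by (rule tensor_series_eqI) (simp add: teval_tproj)

lemma tproj_scaleR: "tproj k (c *\<^sub>R A) = c *\<^sub>R tproj k A"
  by (rule tensor_series_eqI) (simp add: teval_tproj)

lemma tproj_sum: "tproj k (\<Sum>i\<in>I. A i) = (\<Sum>i\<in>I. tproj k (A i))"
  by (induction I rule: infinite_finite_induct) (auto simp: tproj_add)

lemma tproj_homogeneous: "tproj j B = B \<Longrightarrow> j \<noteq> k \<Longrightarrow> tproj k B = 0"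
  using tproj_tproj[of k j B] by simp

lemma teval_homogeneous: "tproj j B = B \<Longrightarrow> length w \<noteq> j \<Longrightarrow> teval B w = 0"
  by (metis teval_tproj)

lemma ttrunc_eq_self:
  assumes "\<And>k. k > n \<Longrightarrow> tproj k A = 0"
  shows "ttrunc n A = A"
proof (rule tensor_series_eqI)
  fix w
  have "teval A w = 0" if "length w > n"
    using arg_cong[OF assms[OF that], of "\<lambda>B. teval B w"] by (simp add: teval_tproj)
  then show "teval (ttrunc n A) w = teval A w"
    by (auto simp: ttrunc_def teval_tproj)
qed

lemma finite_degree_eq_ttrunc:
  assumes "finite_degree c" obtains n where "ttrunc n c = c"
proof -
  from assms obtain n where "\<forall>k\<in>{k. tproj k c \<noteq> 0}. k \<le> n"
    unfolding finite_degree_def finite_nat_set_iff_bounded_le by blast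
  then have "ttrunc n c = c"
    by (intro ttrunc_eq_self) fastforce
  then show thesis by (rule that)
qed

lemma finite_degree_homogeneous: "tproj k c = c \<Longrightarrow> finite_degree c"
  unfolding finite_degree_def
  by (rule finite_subset[of _ "{k}"]) (auto dest: tproj_homogeneous)

lemma finite_degree_tproj: "finite_degree (tproj k c)"
  by (rule finite_degree_homogeneous[of k]) simp

lemma teval_mult_homogeneous_right:
  assumes "tproj j B = B"
  shows "teval (A * B) w = (if j \<le> length w
    then teval A (take (length w - j) w) * teval B (drop (length w - j) w) else 0)"
proof -
  \<comment> \<open>The conjunct \<open>j \<le> length w\<close> guards the truncated subtraction:
    on shorter words \<open>length w - j\<close> is 0 and would select the cut
    \<open>k = 0\<close>.\<close>
  have "teval (A * B) w = (\<Sum>k\<le>length w. if k = length w - j \<and> j \<le> length w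
      then teval A (take k w) * teval B (drop k w) else 0)"
    unfolding teval_mult using teval_homogeneous[OF assms]
    by (intro sum.cong refl) auto
  then show ?thesis by (auto simp: if_distrib cong: if_cong)
qed

lemma teval_mult_homogeneous_left:
  assumes "tproj j A = A"
  shows "teval (A * B) w = (if j \<le> length w
    then teval A (take j w) * teval B (drop j w) else 0)"
proof -
  have "teval (A * B) w = (\<Sum>k\<le>length w. if k = j
      then teval A (take k w) * teval B (drop k w) else 0)"
    unfolding teval_mult using teval_homogeneous[OF assms]
    by (intro sum.cong refl) auto
  then show ?thesis by auto
qed

lemma tproj_mult_homogeneous_right:
  assumes "tproj j B = B"
  shows "tproj (m + j) (A * B) = tproj m A * B"
  by (rule tensor_series_eqI)
    (auto simp: teval_tproj teval_mult_homogeneous_right[OF assms])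

lemma tproj_mult:
  "tproj n (A * B) = (\<Sum>i\<le>n. tproj i A * tproj (n - i) B)"
proof (rule tensor_series_eqI)
  fix w
  have "teval (tproj i A * tproj (n - i) B) w =
      (if length w = n then teval A (take i w) * teval B (drop i w) else 0)" if "i \<le> n" for i
    using that by (subst teval_mult_homogeneous_right) (auto simp: teval_tproj)
  then show "teval (tproj n (A * B)) w = teval (\<Sum>i\<le>n. tproj i A * tproj (n - i) B) w"
    by (simp add: teval_tproj teval_mult)
qed


section \<open>The Hilbert--Schmidt inner products\<close>

lemma onb_wordsD: "w \<in> onb_words k \<Longrightarrow> length w = k"
  by (simp add: onb_words_def)

text \<open>Membership in \<open>hs_forms\<close> only controls squares; polarization, ab = ((a +
  b)^2 - a^2 - b^2) / 2, passes from squares to products.\<close>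

lemma summable_on_teval_mult: "(\<lambda>w. teval A w * teval B w) summable_on onb_words k"
proof -
  have "(\<lambda>w. 1/2 * (teval (A + B) w)\<^sup>2 + (-1/2) * (teval A w)\<^sup>2 + (-1/2) * (teval B w)\<^sup>2)
      summable_on onb_words k"
    by (intro summable_on_cmult_right summable_on_add hs_formsD(3) teval)
  then show ?thesis by (simp add: power2_eq_square algebra_simps)
qed

lemma hs_inner_commute: "hs_inner k A B = hs_inner k B A"
  by (simp add: hs_inner_def mult.commute)

lemma hs_inner_add_left: "hs_inner k (A + B) C = hs_inner k A C + hs_inner k B C"
  unfolding hs_inner_def
  by (simp add: distrib_right infsum_add summable_on_teval_mult)

lemma hs_inner_scaleR_left: "hs_inner k (c *\<^sub>R A) C = c * hs_inner k A C"
  unfolding hs_inner_def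
  by (simp add: mult.assoc infsum_cmult_right')

lemma hs_inner_zero_left [simp]: "hs_inner k 0 C = 0"
  by (simp add: hs_inner_def)

lemma hs_inner_zero_right [simp]: "hs_inner k C 0 = 0"
  by (simp add: hs_inner_def)

lemma hs_inner_diff_left: "hs_inner k (A - B) C = hs_inner k A C - hs_inner k B C"
  using hs_inner_add_left[of k A "(-1) *\<^sub>R B" C] hs_inner_scaleR_left[of k "-1" B C] by simp

lemma hs_inner_add_right: "hs_inner k C (A + B) = hs_inner k C A + hs_inner k C B"
  by (metis hs_inner_add_left hs_inner_commute)

lemma hs_inner_scaleR_right: "hs_inner k C (c *\<^sub>R A) = c * hs_inner k C A"
  by (metis hs_inner_scaleR_left hs_inner_commute)

lemma hs_inner_diff_right: "hs_inner k C (A - B) = hs_inner k C A - hs_inner k C B"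
  by (metis hs_inner_diff_left hs_inner_commute)

lemma hs_inner_sum_left: "hs_inner k (\<Sum>i\<in>I. A i) C = (\<Sum>i\<in>I. hs_inner k (A i) C)"
  by (induction I rule: infinite_finite_induct) (auto simp: hs_inner_add_left)

lemma hs_inner_tproj_left: "hs_inner k (tproj j A) B = (if j = k then hs_inner k A B else 0)"
proof -
  have "hs_inner k (tproj j A) B = (\<Sum>\<^sub>\<infinity>w\<in>onb_words k. if j = k then teval A w * teval B w else 0)"
    unfolding hs_inner_def by (intro infsum_cong) (auto simp: teval_tproj onb_wordsD)
  then show ?thesis by (simp add: hs_inner_def)
qed

lemma hs_inner_tproj_right: "hs_inner k A (tproj j B) = (if j = k then hs_inner k A B else 0)"
  by (metis hs_inner_commute hs_inner_tproj_left)

lemma hs_inner_nonneg: "0 \<le> hs_inner k A A"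
  unfolding hs_inner_def by (intro infsum_nonneg) simp

lemma hs_norm_nonneg [simp]: "0 \<le> hs_norm k A"
  by (simp add: hs_norm_def hs_inner_nonneg)

lemma hs_norm_power2: "(hs_norm k A)\<^sup>2 = hs_inner k A A"
  by (simp add: hs_norm_def hs_inner_nonneg)

lemma hs_norm_zero [simp]: "hs_norm k 0 = 0"
  by (simp add: hs_norm_def)

lemma hs_norm_scaleR: "hs_norm k (c *\<^sub>R A) = \<bar>c\<bar> * hs_norm k A"
  by (simp add: hs_norm_def hs_inner_scaleR_left hs_inner_scaleR_right real_sqrt_mult
      flip: mult.assoc)

lemma hs_norm_tproj: "hs_norm k (tproj j A) = (if j = k then hs_norm k A else 0)"
  by (simp add: hs_norm_def hs_inner_tproj_left hs_inner_tproj_right)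

text \<open>\<open>hs_inner k\<close> sees degree k only, so it is merely semidefinite on series.
  The classical argument with the nonnegative quadratic in t therefore needs a separate case for
  vanishing leading coefficient; otherwise t = b / c is its minimizer.\<close>

lemma hs_inner_Cauchy_Schwarz: "\<bar>hs_inner k A B\<bar> \<le> hs_norm k A * hs_norm k B"
proof -
  let ?a = "hs_inner k A A" and ?b = "hs_inner k A B" and ?c = "hs_inner k B B"
  have q: "0 \<le> ?a - 2 * t * ?b + t\<^sup>2 * ?c" for t
    using hs_inner_nonneg[of k "A - t *\<^sub>R B"]
    by (simp add: hs_inner_diff_left hs_inner_diff_right hs_inner_scaleR_left hs_inner_scaleR_right
        hs_inner_commute[of k B A] power2_eq_square algebra_simps)
  have "?b\<^sup>2 \<le> ?a * ?c"
  proof (cases "?c = 0")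
    case True
    have "?b = 0"
    proof (rule ccontr)
      assume "?b \<noteq> 0"
      \<comment> \<open>For \<open>?c = 0\<close> the quadratic is affine in t, and this t makes it
        equal to -1.\<close>
      then have "2 * ((?a + 1) / (2 * ?b)) * ?b = ?a + 1" by simp
      then show False using q[of "(?a + 1) / (2 * ?b)"] True by simp
    qed
    then show ?thesis using True by simp
  next
    case False
    then have "?c > 0" using hs_inner_nonneg[of k B] by simp
    then show ?thesis using q[of "?b / ?c"] by (simp add: field_simps power2_eq_square)
  qed
  then show ?thesis
    using real_sqrt_le_mono by (fastforce simp: hs_norm_def real_sqrt_mult)
qed

lemma hs_norm_add: "hs_norm k (A + B) \<le> hs_norm k A + hs_norm k B"
proof (rule power2_le_imp_le)
  show "(hs_norm k (A + B))\<^sup>2 \<le> (hs_norm k A + hs_norm k B)\<^sup>2"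
    using hs_inner_Cauchy_Schwarz[of k A B]
    by (simp add: hs_norm_power2 power2_sum hs_inner_add_left hs_inner_add_right
        hs_inner_commute[of k B A])
qed simp

lemma hs_norm_sum: "hs_norm k (\<Sum>i\<in>I. A i) \<le> (\<Sum>i\<in>I. hs_norm k (A i))"
  by (induction I rule: infinite_finite_induct) (auto intro: order_trans[OF hs_norm_add])

section \<open>Concatenation of basis words and norms of products\<close>

lemma bij_betw_append_onb_words:
  "bij_betw (\<lambda>(u, v). u @ v) (onb_words i \<times> onb_words j) (onb_words (i + j))"
  by (rule bij_betwI[where g = "\<lambda>w. (take i w, drop i w)"])
    (auto simp: onb_words_def dest: in_set_takeD in_set_dropD)

lemma infsum_onb_words_append:
  fixes g :: "'a::{real_inner,banach} list \<Rightarrow> real"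
  assumes "g summable_on onb_words (i + j)"
  shows "(\<Sum>\<^sub>\<infinity>w\<in>onb_words (i + j). g w) = (\<Sum>\<^sub>\<infinity>u\<in>onb_words i. \<Sum>\<^sub>\<infinity>v\<in>onb_words j. g (u @ v))"
proof -
  have "(\<lambda>p. g (case p of (u, v) \<Rightarrow> u @ v)) summable_on onb_words i \<times> onb_words j"
    using assms summable_on_reindex_bij_betw[OF bij_betw_append_onb_words] by blast
  then have s: "(\<lambda>(u, v). g (u @ v)) summable_on onb_words i \<times> onb_words j"
    by (simp add: case_prod_beta')
  have "(\<Sum>\<^sub>\<infinity>w\<in>onb_words (i + j). g w) =
      (\<Sum>\<^sub>\<infinity>p\<in>onb_words i \<times> onb_words j. g (case p of (u, v) \<Rightarrow> u @ v))"
    by (rule infsum_reindex_bij_betw[OF bij_betw_append_onb_words, symmetric])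
  also have "\<dots> = (\<Sum>\<^sub>\<infinity>(u, v)\<in>onb_words i \<times> onb_words j. g (u @ v))"
    by (simp add: case_prod_beta')
  also have "\<dots> = (\<Sum>\<^sub>\<infinity>u\<in>onb_words i. \<Sum>\<^sub>\<infinity>v\<in>onb_words j. g (u @ v))"
    by (rule infsum_Sigma'_banach[OF s, symmetric])
  finally show ?thesis .
qed

text \<open>On a word u @ v of length i + j the only surviving cut gives u to A and v to B, so the
  double sum of squares factorizes. A may have components in every degree.\<close>

lemma hs_norm_mult_homogeneous:
  assumes B: "tproj j B = B"
  shows "hs_norm (i + j) (A * B) = hs_norm i A * hs_norm j B"
proof -
  have "hs_inner (i + j) (A * B) (A * B) = (\<Sum>\<^sub>\<infinity>u\<in>onb_words i. \<Sum>\<^sub>\<infinity>v\<in>onb_words j.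
      teval (A * B) (u @ v) * teval (A * B) (u @ v))"
    unfolding hs_inner_def by (rule infsum_onb_words_append[OF summable_on_teval_mult])
  also have "\<dots> = (\<Sum>\<^sub>\<infinity>u\<in>onb_words i. \<Sum>\<^sub>\<infinity>v\<in>onb_words j.
      (teval A u * teval A u) * (teval B v * teval B v))"
    by (intro infsum_cong) (auto simp: teval_mult_homogeneous_right[OF B] onb_wordsD)
  also have "\<dots> = hs_inner i A A * hs_inner j B B"
    by (simp add: hs_inner_def infsum_cmult_right' infsum_cmult_left')
  finally show ?thesis by (simp add: hs_norm_def real_sqrt_mult)
qed

lemma hs_norm_mult: "hs_norm n (A * B) \<le> (\<Sum>i\<le>n. hs_norm i A * hs_norm (n - i) B)"
proof -
  have "hs_norm n (A * B) = hs_norm n (tproj n (A * B))" by (simp add: hs_norm_tproj)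
  also have "\<dots> \<le> (\<Sum>i\<le>n. hs_norm n (tproj i A * tproj (n - i) B))"
    unfolding tproj_mult by (rule hs_norm_sum)
  also have "\<dots> = (\<Sum>i\<le>n. hs_norm i A * hs_norm (n - i) B)"
  proof (rule sum.cong[OF refl])
    fix i assume "i \<in> {..n}"
    then show "hs_norm n (tproj i A * tproj (n - i) B) = hs_norm i A * hs_norm (n - i) B"
      using hs_norm_mult_homogeneous[of "n - i" "tproj (n - i) B" i "tproj i A"]
      by (simp add: hs_norm_tproj)
  qed
  finally show ?thesis .
qed

section \<open>Basis words determine a homogeneous component\<close>

lemma bounded_linear_teval:
  "bounded_linear (\<lambda>v. teval A (u @ v # w))"
proof -
  obtain C where C: "\<And>z. length z = length u + length w + 1 \<Longrightarrow>
      \<bar>teval A z\<bar> \<le> C * prod_list (map norm z)"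
    using hs_formsD(2)[OF teval] by blast
  show ?thesis
  proof (rule bounded_linear_intro)
    fix v
    show "norm (teval A (u @ v # w)) \<le>
        norm v * (C * (prod_list (map norm u) * prod_list (map norm w)))"
      using C[of "u @ v # w"] by (simp add: ac_simps)
  qed (use hs_formsD(1)[OF teval, of A u w] in \<open>auto simp: linear_iff\<close>)
qed

lemma tproj_eq_zeroI:
  assumes "hs_norm k A = 0"
  shows "tproj k A = 0"
proof -
  have z: "teval A w = 0" if "w \<in> onb_words k" for w
  proof -
    have "hs_inner k A A \<le> 0" using assms hs_norm_power2[of k A] by simp
    then have "teval A w * teval A w = 0"
      unfolding hs_inner_def
      by (rule nonneg_infsum_le_0D) (use that in \<open>auto intro: summable_on_teval_mult\<close>)
    then show ?thesis by simp
  qed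
  \<comment> \<open>Arbitrary vectors are in \<open>u\<close>, basis vectors in \<open>w\<close>.
    Reverse induction frees the last letter of \<open>u\<close>, which borders \<open>w\<close>: the
    induction hypothesis with \<open>e # w\<close> covers each basis vector \<open>e\<close> in that
    slot.\<close>
  have "teval A (u @ w) = 0" if "set w \<subseteq> onb" "length u + length w = k" for u w
    using that
  proof (induction u arbitrary: w rule: rev_induct)
    case Nil then show ?case by (auto intro: z simp: onb_words_def)
  next
    case (snoc v u)
    have "teval A (u @ v # w) = 0"
    proof -
      have lin: "bounded_linear (\<lambda>v. teval A (u @ v # w))" by (rule bounded_linear_teval)
      have on: "teval A (u @ e # w) = 0" if "e \<in> onb" for e
        using snoc.IH[of "e # w"] snoc.prems that by simp
      have sp: "teval A (u @ e # w) = 0" if "e \<in> span onb" for e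
        using linear_eq_0_on_span[OF bounded_linear.linear[OF lin] on that] by simp
      have "v \<in> closure (span onb)"
        using orthonormal_basis_onb by (auto simp: orthonormal_basis_def)
      moreover have "continuous_on (closure (span onb)) (\<lambda>v. teval A (u @ v # w))"
        using linear_continuous_on[OF lin] by simp
      ultimately show ?thesis
        using continuous_constant_on_closure[of "span onb" "\<lambda>v. teval A (u @ v # w)" 0 v] sp
        by blast
    qed
    then show ?case by simp
  qed
  from this[of "[]"] show ?thesis
    by (intro tensor_series_eqI) (auto simp: teval_tproj)
qed

lemma tproj_eqI:
  assumes "\<And>c. tproj k c = c \<Longrightarrow> hs_inner k A c = hs_inner k B c"
  shows "tproj k A = tproj k B"
proof -
  have "hs_inner k (A - B) (tproj k (A - B)) = 0"
    using assms[of "tproj k (A - B)"] by (simp add: hs_inner_diff_left)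
  then have "tproj k (A - B) = 0"
    by (intro tproj_eq_zeroI) (simp add: hs_norm_def hs_inner_tproj_right)
  then show ?thesis by (simp add: tproj_diff)
qed

lemma tensor_series_eq_tprojI:
  assumes "\<And>k. tproj k A = tproj k B" shows "A = B"
  by (rule tensor_series_eqI) (metis assms teval_tproj)

section \<open>The algebra E\<close>

lemma E_spaceD: "A \<in> E_space \<Longrightarrow> summable (\<lambda>k. hs_norm k A)"
  by (simp add: E_space_def)

lemma E_norm_nonneg: "A \<in> E_space \<Longrightarrow> 0 \<le> E_norm A"
  unfolding E_norm_def by (intro suminf_nonneg E_spaceD) auto

lemma hs_norm_le_E_norm: "A \<in> E_space \<Longrightarrow> hs_norm k A \<le> E_norm A"
  unfolding E_norm_def using sum_le_suminf[OF E_spaceD, of A "{k}"] by simp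

lemma hs_norm_homogeneous:
  assumes "tproj k c = c" "j \<noteq> k" shows "hs_norm j c = 0"
  by (metis assms hs_norm_tproj)

lemma E_space_homogeneous: "tproj k c = c \<Longrightarrow> c \<in> E_space"
  unfolding E_space_def mem_Collect_eq
  by (rule summable_finite[of "{k}"]) (auto simp: hs_norm_homogeneous)

lemma E_norm_homogeneous: "tproj k c = c \<Longrightarrow> E_norm c = hs_norm k c"
  unfolding E_norm_def
  by (subst suminf_finite[of "{k}"]) (auto simp: hs_norm_homogeneous)

lemma E_space_tproj [simp]: "tproj k A \<in> E_space"
  by (rule E_space_homogeneous[of k]) simp

lemma E_space_zero [simp]: "0 \<in> E_space"
  by (rule E_space_homogeneous[of 0]) simp

lemma E_space_add: "A \<in> E_space \<Longrightarrow> B \<in> E_space \<Longrightarrow> A + B \<in> E_space"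
  unfolding E_space_def mem_Collect_eq
  by (rule summable_comparison_test'[of "\<lambda>k. hs_norm k A + hs_norm k B" 0])
    (auto intro: summable_add hs_norm_add)

lemma E_space_scaleR: "A \<in> E_space \<Longrightarrow> c *\<^sub>R A \<in> E_space"
  unfolding E_space_def by (simp add: hs_norm_scaleR summable_mult)

lemma E_space_diff: "A \<in> E_space \<Longrightarrow> B \<in> E_space \<Longrightarrow> A - B \<in> E_space"
  using E_space_add[of A "(-1) *\<^sub>R B"] E_space_scaleR[of B "-1"] by simp

lemma E_space_sum: "(\<And>i. i \<in> I \<Longrightarrow> A i \<in> E_space) \<Longrightarrow> (\<Sum>i\<in>I. A i) \<in> E_space"
  by (induction I rule: infinite_finite_induct) (auto intro: E_space_add)

lemma E_space_ttrunc: "ttrunc n A \<in> E_space"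
  unfolding ttrunc_def by (intro E_space_sum) simp

lemma E_space_finite_degree: "finite_degree c \<Longrightarrow> c \<in> E_space"
  by (metis finite_degree_eq_ttrunc E_space_ttrunc)

lemma summable_E_norm_mult:
  assumes "A \<in> E_space" "B \<in> E_space"
  shows "summable (\<lambda>n. \<Sum>i\<le>n. hs_norm i A * hs_norm (n - i) B)"
  using assms by (intro summable_Cauchy_product) (auto simp: E_space_def)

lemma E_space_mult:
  assumes "A \<in> E_space" "B \<in> E_space" shows "A * B \<in> E_space"
  unfolding E_space_def mem_Collect_eq
  by (rule summable_comparison_test'[OF summable_E_norm_mult[OF assms], of 0])
    (simp add: hs_norm_mult)

lemma E_norm_mult:
  assumes "A \<in> E_space" "B \<in> E_space" shows "E_norm (A * B) \<le> E_norm A * E_norm B"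
proof -
  have "E_norm (A * B) \<le> (\<Sum>n. \<Sum>i\<le>n. hs_norm i A * hs_norm (n - i) B)"
    unfolding E_norm_def
    by (intro suminf_le hs_norm_mult E_spaceD[OF E_space_mult] summable_E_norm_mult assms)
  also have "\<dots> = E_norm A * E_norm B"
    unfolding E_norm_def using assms
    by (intro Cauchy_product[symmetric]) (auto simp: E_space_def)
  finally show ?thesis .
qed

text \<open>After Cauchy-Schwarz in each degree, one factor is bounded uniformly by
  \<open>E_norm B\<close> and only the other is summed.\<close>

lemma summable_hs_inner_aux:
  assumes "A \<in> E_space" "B \<in> E_space"
  shows "summable (\<lambda>k. \<bar>hs_inner k A B\<bar>)" (is ?s)
    and "(\<Sum>k. \<bar>hs_inner k A B\<bar>) \<le> E_norm A * E_norm B" (is ?b)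
proof -
  have le: "\<bar>hs_inner k A B\<bar> \<le> hs_norm k A * E_norm B" for k
    by (rule order_trans[OF hs_inner_Cauchy_Schwarz])
      (intro mult_left_mono hs_norm_le_E_norm assms hs_norm_nonneg)
  have s: "summable (\<lambda>k. hs_norm k A * E_norm B)"
    by (intro summable_mult2 E_spaceD assms)
  show ?s by (rule summable_comparison_test'[OF s, of 0]) (use le in auto)
  then have "(\<Sum>k. \<bar>hs_inner k A B\<bar>) \<le> (\<Sum>k. hs_norm k A * E_norm B)"
    by (intro suminf_le le s)
  also have "\<dots> = E_norm A * E_norm B"
    using suminf_mult2[OF E_spaceD[OF assms(1)], of "E_norm B"] by (simp add: E_norm_def)
  finally show ?b .
qed

lemma summable_hs_inner:
  "A \<in> E_space \<Longrightarrow> B \<in> E_space \<Longrightarrow> summable (\<lambda>k. hs_inner k A B)"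
  by (rule summable_rabs_cancel[OF summable_hs_inner_aux(1)])

lemma tinner_bound:
  assumes "A \<in> E_space" "B \<in> E_space"
  shows "\<bar>tinner A B\<bar> \<le> E_norm A * E_norm B"
  unfolding tinner_def
  using summable_rabs[OF summable_hs_inner_aux(1)[OF assms]] summable_hs_inner_aux(2)[OF assms]
  by linarith

lemma tinner_commute: "tinner A B = tinner B A"
  by (simp add: tinner_def hs_inner_commute)

lemma tinner_zero_left [simp]: "tinner 0 A = 0"
  by (simp add: tinner_def)

lemma tinner_add_left:
  "A \<in> E_space \<Longrightarrow> B \<in> E_space \<Longrightarrow> C \<in> E_space \<Longrightarrow> tinner (A + B) C = tinner A C + tinner B C"
  unfolding tinner_def by (simp add: hs_inner_add_left suminf_add summable_hs_inner)

lemma tinner_scaleR_left: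
  "A \<in> E_space \<Longrightarrow> C \<in> E_space \<Longrightarrow> tinner (c *\<^sub>R A) C = c * tinner A C"
  unfolding tinner_def by (simp add: hs_inner_scaleR_left suminf_mult summable_hs_inner)

lemma tinner_diff_left:
  "A \<in> E_space \<Longrightarrow> B \<in> E_space \<Longrightarrow> C \<in> E_space \<Longrightarrow> tinner (A - B) C = tinner A C - tinner B C"
  using tinner_add_left[of A "(-1) *\<^sub>R B" C] tinner_scaleR_left[of B C "-1"] E_space_scaleR[of B "-1"]
  by simp

lemma tinner_add_right:
  "A \<in> E_space \<Longrightarrow> B \<in> E_space \<Longrightarrow> C \<in> E_space \<Longrightarrow> tinner C (A + B) = tinner C A + tinner C B"
  by (simp add: tinner_add_left tinner_commute[of C])

lemma tinner_scaleR_right: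
  "A \<in> E_space \<Longrightarrow> C \<in> E_space \<Longrightarrow> tinner C (c *\<^sub>R A) = c * tinner C A"
  by (simp add: tinner_scaleR_left tinner_commute[of C])

lemma tinner_sum_left:
  assumes "\<And>i. i \<in> I \<Longrightarrow> A i \<in> E_space" "C \<in> E_space"
  shows "tinner (\<Sum>i\<in>I. A i) C = (\<Sum>i\<in>I. tinner (A i) C)"
  using assms
  by (induction I rule: infinite_finite_induct) (auto simp: tinner_add_left E_space_sum)

lemma tinner_sum_right:
  assumes "\<And>i. i \<in> I \<Longrightarrow> A i \<in> E_space" "C \<in> E_space"
  shows "tinner C (\<Sum>i\<in>I. A i) = (\<Sum>i\<in>I. tinner C (A i))"
  using tinner_sum_left[OF assms] by (simp add: tinner_commute[of C])

lemma tinner_homogeneous_right: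
  assumes "tproj k c = c" shows "tinner A c = hs_inner k A c"
proof -
  have "hs_inner j A c = 0" if "j \<noteq> k" for j
    using hs_inner_tproj_right[of j A k c] that by (simp add: assms)
  then show ?thesis
    unfolding tinner_def by (subst suminf_finite[of "{k}"]) auto
qed

lemma tinner_homogeneous_left: "tproj k c = c \<Longrightarrow> tinner c A = hs_inner k c A"
  by (metis tinner_homogeneous_right tinner_commute hs_inner_commute)


section \<open>Riesz representation on the finite-degree series\<close>

text \<open>The elementary tensor of the entries of \<open>w\<close>. For words over
  \<open>onb\<close> these tensors form the orthonormal basis whose coordinates
  \<open>hs_inner\<close> sums over.\<close>

definition pure :: "'a::{real_inner,banach} list \<Rightarrow> 'a tensor_series" where
  "pure w = prod_list (map tvec w)"

lemma tproj_tvec: "tproj 1 (tvec v) = tvec v"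
  by (rule tensor_series_eqI) (auto simp: teval_tproj teval_tvec length_Suc_conv split: list.splits)

lemma tproj_pure: "tproj (length w) (pure w) = pure w"
proof (induction w rule: rev_induct)
  case Nil then show ?case by (simp add: pure_def tproj_one)
next
  case (snoc v w)
  have "tproj (length w + 1) (pure w * tvec v) = tproj (length w) (pure w) * tvec v"
    by (rule tproj_mult_homogeneous_right[OF tproj_tvec])
  then show ?case using snoc by (simp add: pure_def)
qed

lemma teval_mult_snoc_tvec: "teval (A * tvec v) (w @ [u]) = teval A w * inner v u"
  by (simp add: teval_mult_homogeneous_right[OF tproj_tvec] teval_tvec)

lemma inner_onb:
  fixes e e' :: "'a::{real_inner,banach}"
  assumes "e \<in> onb" "e' \<in> onb" shows "inner e e' = (if e = e' then 1 else 0)"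
  using orthonormal_basis_onb assms
  by (auto simp: orthonormal_basis_def pairwise_def orthogonal_def norm_eq_1)

lemma teval_pure_onb:
  "set w \<subseteq> onb \<Longrightarrow> set z \<subseteq> onb \<Longrightarrow> teval (pure w) z = (if z = w then 1 else 0)"
proof (induction w arbitrary: z rule: rev_induct)
  case Nil then show ?case by (simp add: pure_def teval_one)
next
  case (snoc v w)
  show ?case
  proof (cases z rule: rev_cases)
    case Nil
    then show ?thesis using teval_homogeneous[OF tproj_pure[of "w @ [v]"], of z] by simp
  next
    case (snoc z' u)
    have "pure (w @ [v]) = pure w * tvec v" by (simp add: pure_def)
    then have "teval (pure (w @ [v])) z = teval (pure w) z' * inner v u"
      using snoc by (simp add: teval_mult_snoc_tvec)
    moreover have "teval (pure w) z' = (if z' = w then 1 else 0)"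
      using snoc snoc.prems by (intro snoc.IH) auto
    moreover have "inner v u = (if v = u then 1 else 0)"
      using snoc snoc.prems by (intro inner_onb) auto
    ultimately show ?thesis using snoc by auto
  qed
qed

text \<open>Quantitative form of \<open>bessel_onb\<close>, from the nonnegative squared length of v
  minus its projection onto the span of F. The explicit constant is what makes \<open>tvec\<close>
  norm-nonincreasing and so gives \<open>hs_norm_pure_le\<close>.\<close>

lemma bessel_inequality_onb:
  fixes v :: "'a::{real_inner,banach}"
  assumes F: "F \<subseteq> onb" "finite F"
  shows "(\<Sum>e\<in>F. (inner v e)\<^sup>2) \<le> (norm v)\<^sup>2"
proof -
  let ?q = "\<Sum>e\<in>F. inner v e *\<^sub>R e"
  have q1: "inner v ?q = (\<Sum>e\<in>F. (inner v e)\<^sup>2)"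
    by (simp add: inner_sum_right power2_eq_square)
  have "(\<Sum>e'\<in>F. inner v e' * inner e' e) = inner v e" if e: "e \<in> F" for e
  proof -
    have "(\<Sum>e'\<in>F. inner v e' * inner e' e) = (\<Sum>e'\<in>F. if e' = e then inner v e' else 0)"
      using F e by (intro sum.cong refl) (auto simp: inner_onb subset_iff)
    then show ?thesis using e F by simp
  qed
  then have q2: "inner ?q ?q = (\<Sum>e\<in>F. (inner v e)\<^sup>2)"
    by (simp add: inner_sum_left inner_sum_right power2_eq_square)
  have "0 \<le> inner (v - ?q) (v - ?q)" by (rule inner_ge_zero)
  also have "\<dots> = inner v v - 2 * inner v ?q + inner ?q ?q"
    by (simp only: inner_diff_left inner_diff_right inner_commute[of ?q v])
  finally show ?thesis unfolding q1 q2 power2_norm_eq_inner by linarith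
qed

lemma hs_norm_tvec_le: "hs_norm 1 (tvec v) \<le> norm v"
proof (rule power2_le_imp_le)
  have b: "bij_betw (\<lambda>e. [e]) onb (onb_words 1 :: 'a list set)"
    by (rule bij_betwI[where g = hd]) (auto simp: onb_words_def length_Suc_conv)
  have "(hs_norm 1 (tvec v))\<^sup>2 = (\<Sum>\<^sub>\<infinity>e\<in>onb. (inner v e)\<^sup>2)"
    unfolding hs_norm_power2 hs_inner_def
    by (subst infsum_reindex_bij_betw[OF b, symmetric]) (simp add: teval_tvec power2_eq_square)
  also have "\<dots> \<le> (norm v)\<^sup>2"
    by (rule infsum_le_finite_sums[OF bessel_onb]) (rule bessel_inequality_onb)
  finally show "(hs_norm 1 (tvec v))\<^sup>2 \<le> (norm v)\<^sup>2" .
qed simp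

lemma hs_norm_pure_le: "hs_norm (length w) (pure w) \<le> prod_list (map norm w)"
proof (induction w rule: rev_induct)
  case Nil
  have "onb_words 0 = {[] :: 'a list}" by (auto simp: onb_words_def)
  then show ?case by (simp add: pure_def hs_norm_def hs_inner_def teval_one)
next
  case (snoc v w)
  have "hs_norm (length w + 1) (pure w * tvec v) = hs_norm (length w) (pure w) * hs_norm 1 (tvec v)"
    by (rule hs_norm_mult_homogeneous[OF tproj_tvec])
  also have "\<dots> \<le> prod_list (map norm w) * norm v"
    by (intro mult_mono snoc.IH hs_norm_tvec_le prod_list_norm_nonneg hs_norm_nonneg)
  finally show ?case by (simp add: pure_def)
qed

lemma tvec_add: "tvec (v + w) = tvec v + tvec w"
  by (rule tensor_series_eqI) (auto simp: teval_tvec inner_add_left split: list.splits)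

lemma tvec_scaleR: "tvec (c *\<^sub>R v) = c *\<^sub>R tvec v"
  by (rule tensor_series_eqI) (auto simp: teval_tvec split: list.splits)

lemma finite_degree_pure: "finite_degree (pure w)"
  by (rule finite_degree_homogeneous[OF tproj_pure])

lemma hs_inner_pure:
  assumes "w \<in> onb_words k"
  shows "hs_inner k A (pure w) = teval A w"
proof -
  have "hs_inner k A (pure w) = (\<Sum>\<^sub>\<infinity>z\<in>{w}. teval A z * teval (pure w) z)"
    unfolding hs_inner_def using assms
    by (intro infsum_cong_neutral) (auto simp: onb_words_def teval_pure_onb)
  then show ?thesis using assms by (simp add: onb_words_def teval_pure_onb)
qed

section \<open>Finite basis expansions and the representation theorem\<close>

definition onb_partial_sum ::
    "'a::{real_inner,banach} tensor_series \<Rightarrow> 'a list set \<Rightarrow> 'a tensor_series" where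
  "onb_partial_sum c F = (\<Sum>w\<in>F. teval c w *\<^sub>R pure w)"

lemma tproj_onb_partial_sum:
  assumes "F \<subseteq> onb_words k"
  shows "tproj k (onb_partial_sum c F) = onb_partial_sum c F"
proof -
  have "tproj k (pure w) = pure w" if "w \<in> F" for w
    using tproj_pure[of w] onb_wordsD[of w k] that assms by auto
  then show ?thesis
    unfolding onb_partial_sum_def tproj_sum by (intro sum.cong) (auto simp: tproj_scaleR)
qed

lemma teval_onb_partial_sum:
  assumes "F \<subseteq> onb_words k" "finite F" "z \<in> onb_words k"
  shows "teval (onb_partial_sum c F) z = (if z \<in> F then teval c z else 0)"
proof -
  have "teval (onb_partial_sum c F) z = (\<Sum>w\<in>F. if z = w then teval c w else 0)"
    unfolding onb_partial_sum_def teval_sum teval_scaleR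
    using assms by (intro sum.cong refl) (auto simp: teval_pure_onb onb_words_def subset_iff)
  then show ?thesis using assms by (simp)
qed

text \<open>By Pythagoras the squared error is the full sum of squared coefficients minus its
  partial sum over F, and the partial sums converge to the full one.\<close>

lemma onb_partial_sum_tendsto:
  "((\<lambda>F. hs_norm k (c - onb_partial_sum c F)) \<longlongrightarrow> 0) (finite_subsets_at_top (onb_words k))"
proof -
  let ?S = "hs_inner k c c"
  have "hs_inner k (c - onb_partial_sum c F) (c - onb_partial_sum c F) =
      ?S - (\<Sum>w\<in>F. teval c w * teval c w)" if F: "finite F" "F \<subseteq> onb_words k" for F
  proof -
    let ?q = "onb_partial_sum c F"
    \<comment> \<open>At every basis word either \<open>c - ?q\<close> or \<open>?q\<close>
      vanishes, so the cross term is absent already pointwise.\<close>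
    have "?S = (\<Sum>\<^sub>\<infinity>z\<in>onb_words k.
        teval (c - ?q) z * teval (c - ?q) z + teval ?q z * teval ?q z)"
      unfolding hs_inner_def by (intro infsum_cong) (auto simp: teval_onb_partial_sum[OF F(2,1)])
    also have "\<dots> = hs_inner k (c - ?q) (c - ?q)
        + (\<Sum>\<^sub>\<infinity>z\<in>onb_words k. teval ?q z * teval ?q z)"
      unfolding hs_inner_def by (rule infsum_add[OF summable_on_teval_mult summable_on_teval_mult])
    also have "(\<Sum>\<^sub>\<infinity>z\<in>onb_words k. teval (onb_partial_sum c F) z * teval (onb_partial_sum c F) z)
        = (\<Sum>\<^sub>\<infinity>z\<in>F. teval c z * teval c z)"
      using F by (intro infsum_cong_neutral) (auto simp: teval_onb_partial_sum[OF F(2,1)])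
    finally show ?thesis using F by simp
  qed
  then have eq: "hs_norm k (c - onb_partial_sum c F) = sqrt (?S - (\<Sum>w\<in>F. teval c w * teval c w))"
    if "finite F" "F \<subseteq> onb_words k" for F
    using that by (simp add: hs_norm_def)
  have "((\<lambda>F. \<Sum>w\<in>F. teval c w * teval c w) \<longlongrightarrow> ?S) (finite_subsets_at_top (onb_words k))"
    unfolding hs_inner_def by (rule infsum_tendsto[OF summable_on_teval_mult])
  from tendsto_real_sqrt[OF tendsto_diff[OF tendsto_const[of ?S] this]]
  have "((\<lambda>F. sqrt (?S - (\<Sum>w\<in>F. teval c w * teval c w))) \<longlongrightarrow> 0)
      (finite_subsets_at_top (onb_words k))" by simp
  then show ?thesis
    by (rule Lim_transform_eventually)
      (auto intro!: eventually_finite_subsets_at_top_weakI simp: eq)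
qed

text \<open>The representing form can only be \<open>F w = \<Lambda> (pure w)\<close>, taken on all
  words so that it is a genuine multilinear form. Multilinearity comes from \<open>pure\<close> and
  the slotwise bound from \<open>hs_norm_pure_le\<close>. Square summability is duality, and
  agreement with \<Lambda> beyond elementary tensors is continuity in each degree followed by
  additivity over the finitely many degrees.\<close>

lemma riesz_tensor_series:
  fixes \<Lambda> :: "'a::{real_inner,banach} tensor_series \<Rightarrow> real"
  assumes add: "\<And>c d. finite_degree c \<Longrightarrow> finite_degree d \<Longrightarrow> \<Lambda> (c + d) = \<Lambda> c + \<Lambda> d"
    and scale: "\<And>r c. finite_degree c \<Longrightarrow> \<Lambda> (r *\<^sub>R c) = r * \<Lambda> c"
    and bound: "\<And>k c. tproj k c = c \<Longrightarrow> \<bar>\<Lambda> c\<bar> \<le> K * hs_norm k c"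
  shows "\<exists>D. \<forall>c. finite_degree c \<longrightarrow> tinner D c = \<Lambda> c"
proof -
  have zero: "\<Lambda> 0 = 0" using scale[of 0 0] finite_degree_tproj[of 0 0] by simp
  have sum: "\<Lambda> (\<Sum>i\<in>I. r i *\<^sub>R c i) = (\<Sum>i\<in>I. r i * \<Lambda> (c i))"
    if "\<And>i. i \<in> I \<Longrightarrow> tproj k (c i) = c i" for I r c k
    using that
  proof (induction I rule: infinite_finite_induct)
    case (insert i I)
    let ?s = "\<Sum>i\<in>I. r i *\<^sub>R c i"
    have "tproj k ?s = ?s"
      unfolding tproj_sum by (intro sum.cong) (auto simp: tproj_scaleR insert.prems)
    moreover have "tproj k (r i *\<^sub>R c i) = r i *\<^sub>R c i"
      by (simp add: tproj_scaleR insert.prems)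
    ultimately have "\<Lambda> (r i *\<^sub>R c i + ?s) = \<Lambda> (r i *\<^sub>R c i) + \<Lambda> ?s"
      by (intro add finite_degree_homogeneous)
    moreover have "\<Lambda> (r i *\<^sub>R c i) = r i * \<Lambda> (c i)"
      by (rule scale, rule finite_degree_homogeneous[of k]) (simp add: insert.prems)
    moreover have "\<Lambda> ?s = (\<Sum>i\<in>I. r i * \<Lambda> (c i))"
      using insert.IH insert.prems by simp
    ultimately show ?case using insert.hyps by simp
  qed (auto simp: zero)
  define F where "F = (\<lambda>w. \<Lambda> (pure w))"
  have bound_pure: "\<bar>F w\<bar> \<le> \<bar>K\<bar> * prod_list (map norm w)" for w
  proof -
    have "\<bar>F w\<bar> \<le> K * hs_norm (length w) (pure w)"
      unfolding F_def by (rule bound[OF tproj_pure])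
    also have "\<dots> \<le> \<bar>K\<bar> * prod_list (map norm w)"
      by (intro mult_mono hs_norm_pure_le) auto
    finally show ?thesis .
  qed
  have pure_sum: "\<Lambda> (onb_partial_sum c G) = (\<Sum>w\<in>G. teval c w * F w)"
    if "G \<subseteq> onb_words k" for c G k
    unfolding onb_partial_sum_def F_def
  proof (rule sum)
    show "tproj k (pure w) = pure w" if "w \<in> G" for w
      using tproj_pure[of w] onb_wordsD[of w k] that \<open>G \<subseteq> onb_words k\<close> by auto
  qed
  have "F \<in> hs_forms"
  proof (rule hs_formsI)
    fix u w :: "'a list"
    have p: "pure (u @ v # w) = pure u * tvec v * pure w" for v
      by (simp add: pure_def mult.assoc)
    have "pure (u @ (v + v') # w) = pure (u @ v # w) + pure (u @ v' # w)" for v v'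
      by (simp add: p tvec_add algebra_simps)
    moreover have "pure (u @ (r *\<^sub>R v) # w) = r *\<^sub>R pure (u @ v # w)" for r v
      by (simp add: p tvec_scaleR)
    ultimately show "linear (\<lambda>v. F (u @ v # w))"
      by (intro linearI) (simp_all add: F_def add scale finite_degree_pure)
  next
    fix k show "\<exists>C. \<forall>w. length w = k \<longrightarrow> \<bar>F w\<bar> \<le> C * prod_list (map norm w)"
      using bound_pure by blast
  next
    fix k
    show "(\<lambda>w. (F w)\<^sup>2) summable_on onb_words k"
    proof (rule nonneg_bdd_above_summable_on)
      show "bdd_above (sum (\<lambda>w. (F w)\<^sup>2) ` {G. G \<subseteq> onb_words k \<and> finite G})"
      proof (rule bdd_aboveI2)
        fix G :: "'a list set" assume "G \<in> {G. G \<subseteq> onb_words k \<and> finite G}"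
        then have G: "G \<subseteq> onb_words k" "finite G" by auto
        \<comment> \<open>The extremal test series: its squared norm and \<Lambda> q are both
          \<open>?s\<close>, so the bound on \<Lambda> gives |q|^2 \<le> K |q| and hence a bound on
          \<open>?s\<close> independent of G.\<close>
        define q where "q = (\<Sum>w\<in>G. F w *\<^sub>R pure w)"
        have hom: "tproj k (pure w) = pure w" if "w \<in> G" for w
          using tproj_pure[of w] onb_wordsD[of w k] that G by auto
        then have q: "tproj k q = q"
          unfolding q_def tproj_sum by (intro sum.cong) (auto simp: tproj_scaleR)
        let ?s = "\<Sum>w\<in>G. (F w)\<^sup>2"
        have "teval q z = F z" if "z \<in> G" for z
        proof -
          have "teval q z = (\<Sum>w\<in>G. if z = w then F w else 0)"
            unfolding q_def teval_sum teval_scaleR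
            using G that by (intro sum.cong refl) (auto simp: teval_pure_onb onb_words_def subset_iff)
          then show ?thesis using that G by simp
        qed
        moreover have "hs_inner k q q = (\<Sum>w\<in>G. F w * hs_inner k q (pure w))"
          using hs_inner_sum_left[of k "\<lambda>w. F w *\<^sub>R pure w" G q, folded q_def]
          by (simp only: hs_inner_scaleR_left hs_inner_commute[of k "pure _" q])
        moreover have "hs_inner k q (pure w) = teval q w" if "w \<in> G" for w
          using that G by (intro hs_inner_pure) auto
        ultimately have qq: "(hs_norm k q)\<^sup>2 = ?s"
          using hs_norm_power2[of k q] by (simp add: power2_eq_square)
        have "\<Lambda> q = (\<Sum>w\<in>G. F w * \<Lambda> (pure w))"
          unfolding q_def by (rule sum[OF hom])
        then have "\<Lambda> q = ?s" by (simp add: F_def power2_eq_square)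
        then have "hs_norm k q * hs_norm k q \<le> K * hs_norm k q"
          using bound[OF q] qq by (simp add: power2_eq_square)
        then have "hs_norm k q \<le> \<bar>K\<bar>"
          using hs_norm_nonneg[of k q] by (cases "hs_norm k q = 0") (auto simp: mult_le_cancel_right)
        then show "?s \<le> \<bar>K\<bar>\<^sup>2" unfolding qq[symmetric] by (intro power_mono) auto
      qed
    qed simp
  qed
  then have evalD: "teval (Abs_tensor_series F) = F" by (simp add: Abs_tensor_series_inverse)
  define D where "D = Abs_tensor_series F"
  \<comment> \<open>The same partial sums over finite G have two limits:
    \<open>hs_inner k c D\<close> by definition of the infinite sum, and \<open>\<Lambda> c\<close>
    because \<Lambda> is bounded and the expansion of \<open>c\<close> converges in norm.\<close>
  have hom: "hs_inner k D c = \<Lambda> c" if c: "tproj k c = c" for k c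
  proof -
    let ?fs = "finite_subsets_at_top (onb_words k :: 'a list set)"
    have "((\<lambda>G. \<Sum>w\<in>G. teval c w * F w) \<longlongrightarrow> hs_inner k c D) ?fs"
      using infsum_tendsto[OF summable_on_teval_mult[where A = c and B = D]]
      by (simp add: hs_inner_def D_def evalD)
    moreover have "((\<lambda>G. \<Sum>w\<in>G. teval c w * F w) \<longlongrightarrow> \<Lambda> c) ?fs"
    proof -
      have "((\<lambda>G. (\<Sum>w\<in>G. teval c w * F w) - \<Lambda> c) \<longlongrightarrow> 0) ?fs"
      proof (rule Lim_null_comparison)
        show "((\<lambda>G. K * hs_norm k (c - onb_partial_sum c G)) \<longlongrightarrow> 0) ?fs"
          using tendsto_mult_left[OF onb_partial_sum_tendsto[of k c], of K] by simp
        show "\<forall>\<^sub>F G in ?fs. norm ((\<Sum>w\<in>G. teval c w * F w) - \<Lambda> c)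
            \<le> K * hs_norm k (c - onb_partial_sum c G)"
        proof (rule eventually_finite_subsets_at_top_weakI)
          fix G :: "'a list set" assume G: "finite G" "G \<subseteq> onb_words k"
          let ?q = "onb_partial_sum c G"
          have q: "tproj k ?q = ?q" by (rule tproj_onb_partial_sum[OF G(2)])
          have d: "tproj k (c - ?q) = c - ?q" by (simp add: tproj_diff c q)
          have "\<Lambda> ((c - ?q) + ?q) = \<Lambda> (c - ?q) + \<Lambda> ?q"
            by (intro add finite_degree_homogeneous[OF d] finite_degree_homogeneous[OF q])
          then have "(\<Sum>w\<in>G. teval c w * F w) - \<Lambda> c = - \<Lambda> (c - ?q)"
            by (simp add: pure_sum[OF G(2)])
          then show "norm ((\<Sum>w\<in>G. teval c w * F w) - \<Lambda> c) \<le> K * hs_norm k (c - ?q)"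
            using bound[OF d] by simp
        qed
      qed
      then show ?thesis by (simp add: LIM_zero_iff)
    qed
    moreover have "?fs \<noteq> bot" by simp
    ultimately have "hs_inner k c D = \<Lambda> c" using tendsto_unique by blast
    then show ?thesis by (simp add: hs_inner_commute)
  qed
  have "tinner D c = \<Lambda> c" if fc: "finite_degree c" for c
  proof -
    obtain n where n: "ttrunc n c = c" using finite_degree_eq_ttrunc[OF fc] .
    have fd: "finite_degree (\<Sum>k\<in>I. tproj k c)" if "finite I" for I
      unfolding finite_degree_def tproj_sum
      by (rule finite_subset[OF _ that]) (auto simp: that split: if_splits)
    have "\<Lambda> (\<Sum>k\<in>I. tproj k c) = (\<Sum>k\<in>I. \<Lambda> (tproj k c))" if "finite I" for I
      using that by induction (auto simp: zero add fd finite_degree_tproj)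
    then have 1: "\<Lambda> c = (\<Sum>k\<le>n. \<Lambda> (tproj k c))" using n by (metis finite_atMost ttrunc_def)
    have "hs_inner k D c = (if k \<le> n then \<Lambda> (tproj k c) else 0)" for k
    proof -
      have "hs_inner k D c = (\<Sum>j\<le>n. hs_inner k D (tproj j c))"
        by (subst n[symmetric]) (simp add: ttrunc_def hs_inner_commute[of k D] hs_inner_sum_left)
      also have "\<dots> = (if k \<le> n then hs_inner k D (tproj k c) else 0)"
        by (simp add: hs_inner_tproj_right)
      finally show ?thesis by (simp add: hom)
    qed
    then have "tinner D c = (\<Sum>k\<le>n. \<Lambda> (tproj k c))"
      unfolding tinner_def by (subst suminf_finite[of "{..n}"]) auto
    then show ?thesis using 1 by simp
  qed
  then show ?thesis by blast
qed

text \<open>The uniqueness half of the definite descriptions \<open>Ladj\<close> and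
  \<open>Radj\<close>.\<close>

lemma tensor_series_eq_tinnerI:
  assumes "\<And>c. finite_degree c \<Longrightarrow> tinner D c = tinner D' c"
  shows "(D :: 'a::{real_inner,banach} tensor_series) = D'"
proof (rule tensor_series_eq_tprojI, rule tproj_eqI)
  fix k and c :: "'a tensor_series" assume c: "tproj k c = c"
  show "hs_inner k D c = hs_inner k D' c"
    using assms[OF finite_degree_homogeneous[OF c]] by (simp only: tinner_homogeneous_right[OF c])
qed

section \<open>Adjoints of tensor multiplication\<close>

lemma Ladj_eqI:
  assumes "\<And>c. finite_degree c \<Longrightarrow> tinner D c = tinner B (A * c)"
  shows "Ladj A B = D"
  unfolding Ladj_def
  by (rule the_equality) (auto simp: assms intro: tensor_series_eq_tinnerI)

lemma Radj_eqI:
  assumes "\<And>c. finite_degree c \<Longrightarrow> tinner D c = tinner B (c * A)"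
  shows "Radj A B = D"
  unfolding Radj_def
  by (rule the_equality) (auto simp: assms intro: tensor_series_eq_tinnerI)

lemma E_norm_mult_homogeneous_le:
  assumes "A \<in> E_space" "tproj k c = c"
  shows "E_norm (A * c) \<le> E_norm A * hs_norm k c" "E_norm (c * A) \<le> E_norm A * hs_norm k c"
  using E_norm_mult[OF assms(1) E_space_homogeneous[OF assms(2)]]
    E_norm_mult[OF E_space_homogeneous[OF assms(2)] assms(1)]
  by (simp_all only: E_norm_homogeneous[OF assms(2)] mult.commute)

lemma tinner_mult_le:
  assumes "A \<in> E_space" "B \<in> E_space" "tproj k c = c"
  shows "\<bar>tinner B (A * c)\<bar> \<le> E_norm A * E_norm B * hs_norm k c"
    and "\<bar>tinner B (c * A)\<bar> \<le> E_norm A * E_norm B * hs_norm k c"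
proof -
  have c: "c \<in> E_space" by (rule E_space_homogeneous[OF assms(3)])
  have "\<bar>tinner B (A * c)\<bar> \<le> E_norm B * (E_norm A * hs_norm k c)"
    using tinner_bound[OF assms(2) E_space_mult[OF assms(1) c]]
      mult_left_mono[OF E_norm_mult_homogeneous_le(1)[OF assms(1,3)] E_norm_nonneg[OF assms(2)]]
    by linarith
  then show "\<bar>tinner B (A * c)\<bar> \<le> E_norm A * E_norm B * hs_norm k c"
    by (simp only: mult_ac)
  have "\<bar>tinner B (c * A)\<bar> \<le> E_norm B * (E_norm A * hs_norm k c)"
    using tinner_bound[OF assms(2) E_space_mult[OF c assms(1)]]
      mult_left_mono[OF E_norm_mult_homogeneous_le(2)[OF assms(1,3)] E_norm_nonneg[OF assms(2)]]
    by linarith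
  then show "\<bar>tinner B (c * A)\<bar> \<le> E_norm A * E_norm B * hs_norm k c"
    by (simp only: mult_ac)
qed

text \<open>The defining equation of a definite description is available only once existence is
  known; \<open>riesz_tensor_series\<close> supplies it with K =
  \<open>E_norm A * E_norm B\<close>.\<close>

lemma tinner_Ladj:
  assumes A: "A \<in> E_space" and B: "B \<in> E_space" and c: "finite_degree c"
  shows "tinner (Ladj A B) c = tinner B (A * c)"
proof -
  have "\<exists>D. \<forall>c. finite_degree c \<longrightarrow> tinner D c = tinner B (A * c)"
  proof (rule riesz_tensor_series)
    show "\<bar>tinner B (A * c)\<bar> \<le> E_norm A * E_norm B * hs_norm k c" if "tproj k c = c" for k c
      by (rule tinner_mult_le(1)[OF A B that])
  qed (auto simp: distrib_left tinner_add_right tinner_scaleR_right E_space_mult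
      E_space_finite_degree A B)
  then obtain D where "\<And>c. finite_degree c \<Longrightarrow> tinner D c = tinner B (A * c)" by blast
  then show ?thesis using c Ladj_eqI by metis
qed

lemma tinner_Radj:
  assumes A: "A \<in> E_space" and B: "B \<in> E_space" and c: "finite_degree c"
  shows "tinner (Radj A B) c = tinner B (c * A)"
proof -
  have "\<exists>D. \<forall>c. finite_degree c \<longrightarrow> tinner D c = tinner B (c * A)"
  proof (rule riesz_tensor_series)
    show "\<bar>tinner B (c * A)\<bar> \<le> E_norm A * E_norm B * hs_norm k c" if "tproj k c = c" for k c
      by (rule tinner_mult_le(2)[OF A B that])
  qed (auto simp: distrib_right tinner_add_right tinner_scaleR_right E_space_mult
      E_space_finite_degree A B)
  then obtain D where "\<And>c. finite_degree c \<Longrightarrow> tinner D c = tinner B (c * A)" by blast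
  then show ?thesis using c Radj_eqI by metis
qed

lemma hs_inner_Ladj:
  assumes "A \<in> E_space" "B \<in> E_space" "tproj k c = c"
  shows "hs_inner k (Ladj A B) c = tinner B (A * c)"
  using tinner_Ladj[OF assms(1,2) finite_degree_homogeneous[OF assms(3)]]
  by (simp only: tinner_homogeneous_right[OF assms(3)])

text \<open>Testing the adjoint against its own degree-k component yields N^2 \<le> |A| |B| N. This
  is the continuity used to differentiate \<open>Ladj Q (Z v)\<close> degree by degree.\<close>

lemma hs_norm_Ladj_le:
  assumes "A \<in> E_space" "B \<in> E_space"
  shows "hs_norm k (Ladj A B) \<le> E_norm A * E_norm B"
proof -
  let ?L = "Ladj A B" and ?N = "hs_norm k (Ladj A B)"
  have c: "tproj k (tproj k ?L) = tproj k ?L" by simp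
  have "?N * ?N = hs_inner k ?L (tproj k ?L)"
    using hs_norm_power2[of k ?L] by (simp add: hs_inner_tproj_right power2_eq_square)
  also have "\<dots> = tinner B (A * tproj k ?L)" by (rule hs_inner_Ladj[OF assms c])
  also have "\<dots> \<le> E_norm A * E_norm B * ?N"
    using tinner_mult_le(1)[OF assms c] by (simp add: hs_norm_tproj)
  finally have "?N * ?N \<le> E_norm A * E_norm B * ?N" .
  moreover have "0 \<le> E_norm A * E_norm B" using assms by (simp add: E_norm_nonneg)
  ultimately show ?thesis
    using hs_norm_nonneg[of k ?L] by (cases "?N = 0") (auto simp: mult_le_cancel_right)
qed

lemma Ladj_add:
  assumes "A \<in> E_space" "B \<in> E_space" "C \<in> E_space"
  shows "Ladj A (B + C) = Ladj A B + Ladj A C"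
proof (rule tensor_series_eq_tprojI, rule tproj_eqI)
  fix k and c :: "'a tensor_series" assume c: "tproj k c = c"
  then show "hs_inner k (Ladj A (B + C)) c = hs_inner k (Ladj A B + Ladj A C) c"
    using assms E_space_homogeneous[OF c]
    by (simp add: hs_inner_Ladj hs_inner_add_left E_space_add E_space_mult tinner_add_left)
qed

lemma Ladj_scaleR:
  assumes "A \<in> E_space" "B \<in> E_space"
  shows "Ladj A (r *\<^sub>R B) = r *\<^sub>R Ladj A B"
proof (rule tensor_series_eq_tprojI, rule tproj_eqI)
  fix k and c :: "'a tensor_series" assume c: "tproj k c = c"
  then show "hs_inner k (Ladj A (r *\<^sub>R B)) c = hs_inner k (r *\<^sub>R Ladj A B) c"
    using assms E_space_homogeneous[OF c]
    by (simp add: hs_inner_Ladj hs_inner_scaleR_left E_space_scaleR E_space_mult tinner_scaleR_left)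
qed

lemma Ladj_diff:
  assumes "A \<in> E_space" "B \<in> E_space" "C \<in> E_space"
  shows "Ladj A (B - C) = Ladj A B - Ladj A C"
  using Ladj_add[OF assms(1,2) E_space_scaleR[OF assms(3)], of "-1"]
    Ladj_scaleR[OF assms(1,3), of "-1"] by simp

lemma Ladj_zero_left: "Ladj 0 B = 0"
  by (rule Ladj_eqI) (simp add: tinner_commute[of B])

lemma Ladj_zero_right: "Ladj A 0 = 0"
  by (rule Ladj_eqI) simp

lemma Ladj_sum:
  assumes "A \<in> E_space" "\<And>i. i \<in> I \<Longrightarrow> B i \<in> E_space"
  shows "Ladj A (\<Sum>i\<in>I. B i) = (\<Sum>i\<in>I. Ladj A (B i))"
  using assms(2)
proof (induction I rule: infinite_finite_induct)
  case (insert i I)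
  then show ?case by (simp add: Ladj_add[OF assms(1)] E_space_sum)
qed (simp_all add: Ladj_zero_right)

text \<open>Testing with \<open>1\<close> reads off the scalar component. It is the source of the
  isolated f terms in the equations for \<phi> and \<psi>.\<close>

lemma tproj_zero_Ladj:
  assumes "A \<in> E_space" "B \<in> E_space"
  shows "tproj 0 (Ladj A B) = tinner B A *\<^sub>R 1"
proof -
  have w: "onb_words 0 = {[] :: 'a list}" by (auto simp: onb_words_def)
  have "teval (Ladj A B) [] = hs_inner 0 (Ladj A B) 1"
    by (simp add: hs_inner_def w teval_one)
  also have "\<dots> = tinner B A" by (subst hs_inner_Ladj[OF assms tproj_one]) simp
  finally show ?thesis
    by (intro tensor_series_eqI) (auto simp: teval_tproj teval_one)
qed

section \<open>Adjoints of homogeneous series and removal of prefixes and suffixes from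
  products\<close>

lemma tproj_Ladj_homogeneous:
  assumes a: "tproj m a = a" and y: "tproj (k + m) y = y"
  shows "tproj k (Ladj a y) = Ladj a y"
proof (rule Ladj_eqI[symmetric])
  fix c :: "'a tensor_series" assume c: "finite_degree c"
  note E = E_space_homogeneous[OF a] E_space_homogeneous[OF y]
  have h: "tproj k (tproj k (Ladj a y)) = tproj k (Ladj a y)" "tproj k (tproj k c) = tproj k c"
    by simp_all
  have m: "tproj (k + m) (a * d) = a * tproj k d" for d
    by (rule tensor_series_eqI)
      (auto simp: teval_tproj teval_mult_homogeneous_left[OF a])
  have "tinner (tproj k (Ladj a y)) c = hs_inner k (Ladj a y) (tproj k c)"
    by (simp add: tinner_homogeneous_left[OF h(1)] hs_inner_tproj_left hs_inner_tproj_right)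
  also have "\<dots> = tinner y (a * tproj k c)" by (rule hs_inner_Ladj[OF E h(2)])
  also have "\<dots> = hs_inner (k + m) y (tproj (k + m) (a * c))"
    by (simp add: tinner_homogeneous_left[OF y] m)
  also have "\<dots> = tinner y (a * c)"
    by (simp add: tinner_homogeneous_left[OF y] hs_inner_tproj_right)
  finally show "tinner (tproj k (Ladj a y)) c = tinner y (a * c)" .
qed

lemma tproj_Radj_homogeneous:
  assumes y: "tproj j y = y" and c: "tproj (m + j) c = c"
  shows "tproj m (Radj y c) = Radj y c"
proof (rule Radj_eqI[symmetric])
  fix d :: "'a tensor_series" assume d: "finite_degree d"
  note E = E_space_homogeneous[OF y] E_space_homogeneous[OF c]
  have h: "tproj m (tproj m (Radj y c)) = tproj m (Radj y c)" "tproj m (tproj m d) = tproj m d"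
    by simp_all
  have "tinner (tproj m (Radj y c)) d = hs_inner m (Radj y c) (tproj m d)"
    by (simp add: tinner_homogeneous_left[OF h(1)] hs_inner_tproj_left hs_inner_tproj_right)
  also have "\<dots> = tinner (Radj y c) (tproj m d)"
    by (simp add: tinner_homogeneous_right[OF h(2)])
  also have "\<dots> = tinner c (tproj m d * y)"
    by (rule tinner_Radj[OF E finite_degree_tproj])
  also have "\<dots> = hs_inner (m + j) c (tproj (m + j) (d * y))"
    by (simp add: tinner_homogeneous_left[OF c] tproj_mult_homogeneous_right[OF y])
  also have "\<dots> = tinner c (d * y)"
    by (simp add: tinner_homogeneous_left[OF c] hs_inner_tproj_right)
  finally show "tinner (tproj m (Radj y c)) d = tinner c (d * y)" .
qed

text \<open>In coordinates \<open>Radj y c\<close> is the contraction of the last j slots of c with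
  y. Pairing with \<open>pure w\<close> isolates the words that begin with w.\<close>

lemma teval_Radj:
  assumes y: "tproj j y = y" and c: "tproj (m + j) c = c" and w: "w \<in> onb_words m"
  shows "teval (Radj y c) w = (\<Sum>\<^sub>\<infinity>v\<in>onb_words j. teval y v * teval c (w @ v))"
proof -
  note E = E_space_homogeneous[OF y] E_space_homogeneous[OF c]
  have pw: "tproj m (pure w) = pure w" using tproj_pure[of w] onb_wordsD[OF w] by simp
  have "teval (Radj y c) w = tinner (Radj y c) (pure w)"
    by (simp add: hs_inner_pure[OF w] tinner_homogeneous_right[OF pw])
  also have "\<dots> = tinner c (pure w * y)" by (rule tinner_Radj[OF E finite_degree_pure])
  also have "\<dots> = hs_inner (m + j) c (pure w * y)" by (rule tinner_homogeneous_left[OF c])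
  also have "\<dots> = (\<Sum>\<^sub>\<infinity>u\<in>onb_words m. \<Sum>\<^sub>\<infinity>v\<in>onb_words j. teval c (u @ v) * teval (pure w * y) (u @ v))"
    unfolding hs_inner_def by (rule infsum_onb_words_append[OF summable_on_teval_mult])
  also have "\<dots> = (\<Sum>\<^sub>\<infinity>u\<in>onb_words m. if u = w
      then \<Sum>\<^sub>\<infinity>v\<in>onb_words j. teval y v * teval c (w @ v) else 0)"
    using w by (intro infsum_cong)
      (auto simp: teval_mult_homogeneous_right[OF y] onb_words_def teval_pure_onb mult.commute
        intro!: infsum_cong infsum_0)
  also have "\<dots> = (\<Sum>\<^sub>\<infinity>u\<in>{w}. \<Sum>\<^sub>\<infinity>v\<in>onb_words j. teval y v * teval c (w @ v))"
    using w by (intro infsum_cong_neutral) auto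
  finally show ?thesis by simp
qed

text \<open>Since y is no longer than c, the last j letters of a word of length l + j are seen by y
  on one side and lie inside c on the other. Summing over them is the contraction of
  \<open>teval_Radj\<close>, and the factor Q is untouched. If l < m, both sides vanish because the
  word is too short for c.\<close>

lemma hs_inner_mult_Radj:
  assumes y: "tproj j y = y" and c: "tproj (m + j) c = c"
  shows "hs_inner (l + j) (P * y) (Q * c) = hs_inner l P (Q * Radj y c)"
proof -
  note R = tproj_Radj_homogeneous[OF y c]
  have "hs_inner (l + j) (P * y) (Q * c) = (\<Sum>\<^sub>\<infinity>u\<in>onb_words l. \<Sum>\<^sub>\<infinity>v\<in>onb_words j.
      teval (P * y) (u @ v) * teval (Q * c) (u @ v))"
    unfolding hs_inner_def by (rule infsum_onb_words_append[OF summable_on_teval_mult])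
  also have "\<dots> = (\<Sum>\<^sub>\<infinity>u\<in>onb_words l. teval P u * teval (Q * Radj y c) u)"
  proof (rule infsum_cong)
    fix u :: "'a list" assume u: "u \<in> onb_words l"
    show "(\<Sum>\<^sub>\<infinity>v\<in>onb_words j. teval (P * y) (u @ v) * teval (Q * c) (u @ v)) =
        teval P u * teval (Q * Radj y c) u"
    proof (cases "m \<le> l")
      case True
      then have d: "drop (l - m) u \<in> onb_words m"
        using u by (auto simp: onb_words_def dest: in_set_dropD)
      have "(\<Sum>\<^sub>\<infinity>v\<in>onb_words j. teval (P * y) (u @ v) * teval (Q * c) (u @ v)) =
          (\<Sum>\<^sub>\<infinity>v\<in>onb_words j. (teval P u * teval Q (take (l - m) u)) *
            (teval y v * teval c (drop (l - m) u @ v)))"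
        using u True
        by (intro infsum_cong)
          (auto simp: teval_mult_homogeneous_right[OF y] teval_mult_homogeneous_right[OF c]
            onb_words_def)
      also have "\<dots> = (teval P u * teval Q (take (l - m) u)) * teval (Radj y c) (drop (l - m) u)"
        by (simp add: infsum_cmult_right' teval_Radj[OF y c d])
      also have "\<dots> = teval P u * teval (Q * Radj y c) u"
        using u True by (simp add: teval_mult_homogeneous_right[OF R] onb_wordsD)
      finally show ?thesis .
    next
      case False
      have "teval (Q * c) (u @ v) = 0" if "v \<in> onb_words j" for v
        using u that False by (simp add: teval_mult_homogeneous_right[OF c] onb_wordsD)
      then show ?thesis using u False
        by (simp add: teval_mult_homogeneous_right[OF R] onb_wordsD infsum_0)
    qed
  qed
  finally show ?thesis by (simp add: hs_inner_def)
qed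

text \<open>Equivalently, \<open>Radj y (Q * c) = Q * Radj y c\<close>: a suffix which is not longer than \<open>c\<close> is
  removed inside \<open>c\<close>.\<close>

lemma tinner_mult_Radj:
  assumes P: "P \<in> E_space" and Q: "Q \<in> E_space"
    and y: "tproj j y = y" and c: "tproj (m + j) c = c"
  shows "tinner (P * y) (Q * c) = tinner P (Q * Radj y c)"
proof -
  \<comment> \<open>\<open>P * y\<close> has nothing below degree j, so shifting the summation index
    by j loses no term.\<close>
  have "hs_inner N (P * y) (Q * c) = 0" if "N < j" for N
    unfolding hs_inner_def using that
    by (intro infsum_0) (simp add: teval_mult_homogeneous_right[OF y] onb_wordsD)
  moreover have "summable (\<lambda>N. hs_inner N (P * y) (Q * c))"
    using P Q E_space_homogeneous[OF y] E_space_homogeneous[OF c]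
    by (intro summable_hs_inner E_space_mult)
  ultimately have "tinner (P * y) (Q * c) = (\<Sum>N. hs_inner (N + j) (P * y) (Q * c))"
    unfolding tinner_def by (subst suminf_split_initial_segment[of _ j]) auto
  then show ?thesis by (simp add: hs_inner_mult_Radj[OF y c] tinner_def)
qed

lemma tinner_mult_hs_inner_Radj:
  assumes P: "P \<in> E_space" and Q: "Q \<in> E_space"
    and y: "tproj j y = y" and c: "tproj (m + j) c = c"
  shows "tinner (P * y) (Q * c) = hs_inner m (Radj y c) (tproj m (Ladj Q P))"
proof -
  note R = tproj_Radj_homogeneous[OF y c]
  have "tinner (P * y) (Q * c) = hs_inner m (Ladj Q P) (Radj y c)"
    unfolding tinner_mult_Radj[OF assms] by (rule hs_inner_Ladj[OF Q P R, symmetric])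
  then show ?thesis by (simp add: hs_inner_tproj_right hs_inner_commute)
qed

text \<open>The case m = 0: contracting all of c leaves the scalar \<open>hs_inner j y c\<close>.
  These diagonal terms make up \<gamma>.\<close>

lemma tinner_mult_same_degree:
  assumes P: "P \<in> E_space" and Q: "Q \<in> E_space"
    and y: "tproj j y = y" and c: "tproj j c = c"
  shows "tinner (P * y) (Q * c) = tinner P Q * hs_inner j y c"
proof -
  have c0: "tproj (0 + j) c = c" using c by simp
  have w: "onb_words 0 = {[] :: 'a list}" by (auto simp: onb_words_def)
  have "teval (Radj y c) [] = hs_inner j y c"
    using teval_Radj[OF y c0, of "[]"] w by (simp add: hs_inner_def)
  then have "Radj y c = hs_inner j y c *\<^sub>R 1"
    using teval_homogeneous[OF tproj_Radj_homogeneous[OF y c0]]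
    by (intro tensor_series_eqI) (auto simp: teval_one)
  then show ?thesis
    using tinner_mult_Radj[OF P Q y c0] by (simp add: tinner_scaleR_right P Q)
qed

text \<open>On words: when a remainder of length m + j is left after deleting a prefix from W * y,
  the deletion happened inside W and y is still intact at the end.\<close>

lemma tproj_Ladj_mult_le:
  assumes Q: "Q \<in> E_space" and W: "W \<in> E_space" and y: "tproj j y = y"
  shows "tproj (m + j) (Ladj Q (W * y)) = tproj m (Ladj Q W) * y"
proof -
  let ?L = "Ladj Q W"
  note yE = E_space_homogeneous[OF y]
  have h: "tproj (m + j) (tproj m ?L * y) = tproj m ?L * y"
    by (simp add: tproj_mult_homogeneous_right[OF y])
  have "tproj (m + j) (Ladj Q (W * y)) = tproj (m + j) (tproj m ?L * y)"
  proof (rule tproj_eqI)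
    fix c :: "'a tensor_series" assume c: "tproj (m + j) c = c"
    note R = tproj_Radj_homogeneous[OF y c]
    have "hs_inner (m + j) (Ladj Q (W * y)) c = tinner (W * y) (Q * c)"
      by (rule hs_inner_Ladj[OF Q E_space_mult[OF W yE] c])
    also have "\<dots> = tinner (Radj y c) (tproj m ?L)"
      by (simp add: tinner_mult_hs_inner_Radj[OF W Q y c] tinner_homogeneous_left[OF R])
    also have "\<dots> = tinner c (tproj m ?L * y)"
      by (rule tinner_Radj[OF yE E_space_homogeneous[OF c] finite_degree_tproj])
    finally show "hs_inner (m + j) (Ladj Q (W * y)) c = hs_inner (m + j) (tproj m ?L * y) c"
      by (simp add: tinner_homogeneous_left[OF c] hs_inner_commute)
  qed
  then show ?thesis by (simp only: h)
qed

text \<open>On words: when only k letters of y remain, the deleted prefix has consumed all of W and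
  m further letters of y. The surplus of Q over W is the component of degree m of
  \<open>Ladj W Q\<close>.\<close>

lemma tproj_Ladj_mult_ge:
  assumes Q: "Q \<in> E_space" and W: "W \<in> E_space" and y: "tproj (m + k) y = y"
  shows "tproj k (Ladj Q (W * y)) = Ladj (tproj m (Ladj W Q)) y"
proof -
  let ?a = "tproj m (Ladj W Q)"
  note yE = E_space_homogeneous[OF y]
  have a: "tproj m ?a = ?a" by simp
  have "tproj k (Ladj Q (W * y)) = tproj k (Ladj ?a y)"
  proof (rule tproj_eqI)
    fix c :: "'a tensor_series" assume c: "tproj k c = c"
    note R = tproj_Radj_homogeneous[OF c y]
    have "hs_inner k (Ladj Q (W * y)) c = tinner (W * y) (Q * c)"
      by (rule hs_inner_Ladj[OF Q E_space_mult[OF W yE] c])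
    \<comment> \<open>Now c is the shorter suffix, so the two sides are exchanged before the suffix
      is stripped from y.\<close>
    also have "\<dots> = tinner (Q * c) (W * y)" by (rule tinner_commute)
    also have "\<dots> = tinner (Radj c y) ?a"
      by (simp add: tinner_mult_hs_inner_Radj[OF Q W c y] tinner_homogeneous_left[OF R])
    also have "\<dots> = tinner y (?a * c)"
      by (rule tinner_Radj[OF E_space_homogeneous[OF c] yE finite_degree_tproj])
    also have "\<dots> = hs_inner k (Ladj ?a y) c"
      by (rule hs_inner_Ladj[OF E_space_tproj yE c, symmetric])
    finally show "hs_inner k (Ladj Q (W * y)) c = hs_inner k (Ladj ?a y) c" .
  qed
  then show ?thesis
    using tproj_Ladj_homogeneous[OF a, of k y] y by (simp add: add.commute)
qed

section \<open>Differentiating the log-ODE solutions\<close>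

text \<open>Pairing the remainder in \<open>has_E_derivative\<close> with Q gives the error of the
  real difference quotient, and \<open>tinner_bound\<close> controls it. Linearity of the pairing is
  used on E, hence the requirement on Z throughout the interval.\<close>

lemma tinner_has_real_derivative:
  assumes Z: "\<And>v. v \<in> {0..1} \<Longrightarrow> Z v \<in> E_space" and D: "D \<in> E_space" and Q: "Q \<in> E_space"
    and der: "has_E_derivative Z D v" and v: "v \<in> {0..1}"
  shows "((\<lambda>v. tinner (Z v) Q) has_real_derivative tinner D Q) (at v within {0..1})"
proof -
  let ?R = "\<lambda>w. (Z w - Z v) /\<^sub>R (w - v) - D"
  have lim: "((\<lambda>w. E_norm (?R w) * E_norm Q) \<longlongrightarrow> 0) (at v within {0..1})"
    using tendsto_mult_right[OF der[unfolded has_E_derivative_def], of "E_norm Q"] by simp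
  have "((\<lambda>w. (tinner (Z w) Q - tinner (Z v) Q) / (w - v) - tinner D Q) \<longlongrightarrow> 0) (at v within {0..1})"
  proof (rule Lim_null_comparison[OF _ lim])
    have "norm ((tinner (Z w) Q - tinner (Z v) Q) / (w - v) - tinner D Q) \<le> E_norm (?R w) * E_norm Q"
      if w: "w \<in> {0..1}" for w
    proof -
      note E = Z[OF w] Z[OF v] D Q
      have R: "?R w \<in> E_space" by (intro E_space_diff E_space_scaleR E)
      have "tinner (?R w) Q = (tinner (Z w) Q - tinner (Z v) Q) / (w - v) - tinner D Q"
        using E by (simp add: tinner_diff_left tinner_scaleR_left E_space_diff E_space_scaleR
            divide_inverse mult.commute)
      then show ?thesis using tinner_bound[OF R Q] by simp
    qed
    then show "\<forall>\<^sub>F w in at v within {0..1}.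
        norm ((tinner (Z w) Q - tinner (Z v) Q) / (w - v) - tinner D Q) \<le> E_norm (?R w) * E_norm Q"
      by (auto simp: eventually_at_filter)
  qed
  then show ?thesis
    by (simp add: has_field_derivative_iff LIM_zero_iff)
qed

lemma Ladj_has_E_derivative:
  assumes Z: "\<And>v. v \<in> {0..1} \<Longrightarrow> Z v \<in> E_space" and D: "D \<in> E_space" and Q: "Q \<in> E_space"
    and der: "has_E_derivative Z D v" and v: "v \<in> {0..1}"
  shows "has_E_derivative (\<lambda>v. tproj k (Ladj Q (Z v))) (tproj k (Ladj Q D)) v"
  unfolding has_E_derivative_def
proof (rule Lim_null_comparison)
  let ?R = "\<lambda>w. (Z w - Z v) /\<^sub>R (w - v) - D"
  let ?P = "\<lambda>w. (tproj k (Ladj Q (Z w)) - tproj k (Ladj Q (Z v))) /\<^sub>R (w - v) - tproj k (Ladj Q D)"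
  show "((\<lambda>w. E_norm Q * E_norm (?R w)) \<longlongrightarrow> 0) (at v within {0..1})"
    using tendsto_mult_left[OF der[unfolded has_E_derivative_def], of "E_norm Q"] by simp
  have "norm (E_norm (?P w)) \<le> E_norm Q * E_norm (?R w)" if w: "w \<in> {0..1}" for w
  proof -
    note E = Z[OF w] Z[OF v] D Q
    have R: "?R w \<in> E_space" by (intro E_space_diff E_space_scaleR E)
    have "?P w = tproj k (Ladj Q (?R w))"
      using E by (simp add: Ladj_diff Ladj_scaleR E_space_diff E_space_scaleR tproj_diff tproj_scaleR)
    moreover have "E_norm (tproj k (Ladj Q (?R w))) = hs_norm k (Ladj Q (?R w))"
      by (subst E_norm_homogeneous[of k]) (simp_all add: hs_norm_tproj)
    ultimately show ?thesis using hs_norm_Ladj_le[OF Q R, of k] by simp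
  qed
  then show "\<forall>\<^sub>F w in at v within {0..1}. norm (E_norm (?P w)) \<le> E_norm Q * E_norm (?R w)"
    by (auto simp: eventually_at_filter)
qed

section \<open>Expansion of products with the generators by degree\<close>

lemma sum_square_triangles:
  fixes g :: "nat \<Rightarrow> nat \<Rightarrow> real"
  shows "(\<Sum>i = 1..n. \<Sum>j = 1..n. g i j) = (\<Sum>k = 1..n. g k k)
    + (\<Sum>k = 1..n - 1. \<Sum>m = 1..n - k. g (m + k) m)
    + (\<Sum>k = 1..n - 1. \<Sum>m = 1..n - k. g m (m + k))"
proof -
  have tri: "(\<Sum>i = 1..n. \<Sum>j = 1..n. if j < i then h i j else 0) =
      (\<Sum>k = 1..n - 1. \<Sum>m = 1..n - k. h (m + k) m)" for h :: "nat \<Rightarrow> nat \<Rightarrow> real"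
  proof -
    have "(\<Sum>i = 1..n. \<Sum>j = 1..n. if j < i then h i j else 0) =
        (\<Sum>(i, j)\<in>{1..n} \<times> {1..n}. if j < i then h i j else 0)"
      by (simp add: sum.cartesian_product)
    also have "\<dots> = (\<Sum>(i, j)\<in>{(i, j). 1 \<le> j \<and> j < i \<and> i \<le> n}. h i j)"
      by (rule sum.mono_neutral_cong_right) (auto split: if_splits)
    \<comment> \<open>The strict triangle is reindexed by the difference k = i - j, which becomes
      the degree of \<phi>^k or \<psi>^k, and by the smaller index m = j.\<close>
    also have "\<dots> = (\<Sum>(k, m)\<in>(SIGMA k:{1..n - 1}. {1..n - k}). h (m + k) m)"
      by (rule sum.reindex_bij_witness[where i = "\<lambda>(k, m). (m + k, m)" and j = "\<lambda>(i, j). (i - j, j)"])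
        auto
    also have "\<dots> = (\<Sum>k = 1..n - 1. \<Sum>m = 1..n - k. h (m + k) m)"
      by (simp add: sum.Sigma)
    finally show ?thesis .
  qed
  have "(\<Sum>i = 1..n. \<Sum>j = 1..n. g i j) = (\<Sum>i = 1..n. \<Sum>j = 1..n.
      (if j = i then g i j else 0) + (if j < i then g i j else 0) + (if i < j then g i j else 0))"
    by (intro sum.cong refl) auto
  \<comment> \<open>The last sum is written with j outside, so that \<open>tri\<close> applies to
    the transpose of g.\<close>
  also have "\<dots> = (\<Sum>i = 1..n. \<Sum>j = 1..n. if j = i then g i j else 0)
      + (\<Sum>i = 1..n. \<Sum>j = 1..n. if j < i then g i j else 0)
      + (\<Sum>j = 1..n. \<Sum>i = 1..n. if i < j then g i j else 0)"
    by (simp add: sum.distrib sum.swap[of "\<lambda>i j. if i < j then g i j else 0"])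
  also have "(\<Sum>i = 1..n. \<Sum>j = 1..n. if j = i then g i j else 0) = (\<Sum>k = 1..n. g k k)"
    by (intro sum.cong refl) simp
  finally show ?thesis
    unfolding tri tri[of "\<lambda>i j. g j i"] .
qed

text \<open>With Q and P standing for the solutions of the x- and y-equation, the three sums are the
  diagonal and the two strict triangles of pairs of degrees: equal pieces, a longer piece of x, a
  longer piece of y.\<close>

lemma tinner_mult_mult_expand:
  assumes P: "P \<in> E_space" and Q: "Q \<in> E_space"
    and x: "\<And>k. tproj k (x k) = x k" and y: "\<And>k. tproj k (y k) = y k"
  shows "tinner (Q * (\<Sum>k = 1..n. x k)) (P * (\<Sum>k = 1..n. y k)) =
    (\<Sum>k = 1..n. hs_inner k (x k) (y k)) * tinner Q P
    + (\<Sum>k = 1..n - 1. hs_inner k (\<Sum>m = 1..n - k. Radj (y m) (x (m + k))) (tproj k (Ladj Q P)))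
    + (\<Sum>k = 1..n - 1. hs_inner k (\<Sum>m = 1..n - k. Radj (x m) (y (m + k))) (tproj k (Ladj P Q)))"
proof -
  let ?g = "\<lambda>i j. tinner (Q * x i) (P * y j)"
  have xE: "x k \<in> E_space" and yE: "y k \<in> E_space" for k
    using E_space_homogeneous[OF x] E_space_homogeneous[OF y] by auto
  have "tinner (Q * (\<Sum>k = 1..n. x k)) (P * (\<Sum>k = 1..n. y k)) = (\<Sum>i = 1..n. \<Sum>j = 1..n. ?g i j)"
    using xE yE P Q
    by (simp add: sum_distrib_left tinner_sum_left tinner_sum_right E_space_mult E_space_sum)
      (rule sum.swap)
  moreover have "?g k k = hs_inner k (x k) (y k) * tinner Q P" for k
    using tinner_mult_same_degree[OF Q P x y] by (simp add: mult.commute)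
  moreover have "?g (m + k) m = hs_inner k (Radj (y m) (x (m + k))) (tproj k (Ladj Q P))" for k m
    using tinner_mult_hs_inner_Radj[OF P Q y, of k m "x (m + k)"] x[of "m + k"]
    by (simp add: tinner_commute[of "Q * _"] add.commute)
  moreover have "?g m (m + k) = hs_inner k (Radj (x m) (y (m + k))) (tproj k (Ladj P Q))" for k m
    using tinner_mult_hs_inner_Radj[OF Q P x, of k m "y (m + k)"] y[of "m + k"]
    by (simp add: add.commute)
  ultimately show ?thesis
    by (simp only: sum_square_triangles[of ?g] hs_inner_sum_left sum_distrib_right)
qed

text \<open>Pieces of degree at most k fall under \<open>tproj_Ladj_mult_le\<close>, the others
  under \<open>tproj_Ladj_mult_ge\<close>. The statement is symmetric enough to serve both
  first-order equations, with \<phi> and \<psi> exchanged.\<close>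

lemma tproj_Ladj_mult_expand:
  assumes Q: "Q \<in> E_space" and W: "W \<in> E_space"
    and y: "\<And>k. tproj k (y k) = y k" and k: "k \<le> n"
    and \<phi>: "\<And>m. \<phi> m = (if m = 0 then 0 else tproj m (Ladj Q W))"
    and \<psi>: "\<And>m. \<psi> m = (if m = 0 then 0 else tproj m (Ladj W Q))"
  shows "tproj k (Ladj Q (W * (\<Sum>j\<le>n. y j))) = tinner Q W *\<^sub>R y k
    + (\<Sum>m = 0..k. \<phi> m * y (k - m)) + (\<Sum>m = 0..n - k. Ladj (\<psi> m) (y (k + m)))"
proof -
  let ?g = "\<lambda>j. tproj k (Ladj Q (W * y j))"
  have yE: "y k \<in> E_space" for k using E_space_homogeneous[OF y] .
  have "tproj k (Ladj Q (W * (\<Sum>j\<le>n. y j))) = (\<Sum>j\<le>n. ?g j)"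
    using yE Q W by (simp add: sum_distrib_left Ladj_sum E_space_mult tproj_sum)
  also have "(\<Sum>j\<le>n. ?g j) = sum ?g ({0..k} \<union> {k + 1..n})"
    using k by (intro sum.cong) auto
  also have "\<dots> = sum ?g {0..k} + sum ?g {k + 1..n}"
    by (rule sum.union_disjoint) auto
  also have "sum ?g {0..k} = (\<Sum>m = 0..k. ?g (k - m))"
    by (rule sum.reindex_bij_witness[of _ "\<lambda>m. k - m" "\<lambda>m. k - m"]) auto
  \<comment> \<open>The conditional restores the scalar component at m = 0, which the convention
    \<phi> 0 = 0 removes.\<close>
  also have "\<dots> = (\<Sum>m = 0..k. (if m = 0 then tinner Q W *\<^sub>R y k else 0) + \<phi> m * y (k - m))"
  proof (rule sum.cong[OF refl])
    fix m assume "m \<in> {0..k}"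
    then have "?g (k - m) = tproj m (Ladj Q W) * y (k - m)"
      using tproj_Ladj_mult_le[OF Q W y, of m "k - m"] by simp
    then show "?g (k - m) = (if m = 0 then tinner Q W *\<^sub>R y k else 0) + \<phi> m * y (k - m)"
      by (simp add: \<phi> tproj_zero_Ladj[OF Q W] tinner_commute)
  qed
  also have "\<dots> = tinner Q W *\<^sub>R y k + (\<Sum>m = 0..k. \<phi> m * y (k - m))"
    by (simp add: sum.distrib)
  also have "sum ?g {k + 1..n} = (\<Sum>m = 1..n - k. ?g (k + m))"
    using k by (intro sum.reindex_bij_witness[of _ "\<lambda>m. k + m" "\<lambda>j. j - k"]) auto
  also have "\<dots> = (\<Sum>m = 1..n - k. Ladj (\<psi> m) (y (k + m)))"
  proof (rule sum.cong[OF refl])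
    fix m assume "m \<in> {1..n - k}"
    then show "?g (k + m) = Ladj (\<psi> m) (y (k + m))"
      using tproj_Ladj_mult_ge[OF Q W, of m k "y (k + m)"] y[of "k + m"] by (simp add: \<psi> add.commute)
  qed
  \<comment> \<open>Here m = 0 would belong to y k, already counted in the first range; \<psi> 0 = 0
    makes the added term vanish.\<close>
  also have "\<dots> = (\<Sum>m = 0..n - k. Ladj (\<psi> m) (y (k + m)))"
    by (rule sum.mono_neutral_left) (auto simp: \<psi> Ladj_zero_left)
  finally show ?thesis .
qed

lemma logn_eq_sum:
  assumes "\<And>k. x k = tproj k (logn n S)"
  shows "logn n S = (\<Sum>k\<le>n. x k)" and "x 0 = 0"
proof -
  have "tproj k (logn n S) = tproj k (tlog S)" if "k \<le> n" for k
    using that by (simp add: logn_def ttrunc_def tproj_sum)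
  then show "logn n S = (\<Sum>k\<le>n. x k)"
    by (simp add: assms logn_def ttrunc_def)
  \<comment> \<open>At the empty word the logarithmic series is an empty sum.\<close>
  have "teval (tlog S) [] = 0" by transfer simp
  then have "tproj 0 (tlog S) = 0"
    by (intro tensor_series_eqI) (auto simp: teval_tproj)
  then show "x 0 = 0"
    by (simp add: assms logn_def ttrunc_def tproj_sum)
qed

theorem theorem5p3:
  fixes p T :: real and n :: nat
    and s s' t t' :: real
    and X Y SX SY :: "real \<Rightarrow> real \<Rightarrow> 'a::{real_inner,banach} tensor_series"
    and A B :: "'a tensor_series"
    and Zx Zy :: "real \<Rightarrow> 'a tensor_series"
    and x y \<alpha> \<beta> :: "nat \<Rightarrow> 'a tensor_series"
    and f :: "real \<Rightarrow> real \<Rightarrow> real" and \<gamma> :: real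
    and \<phi> \<psi> :: "nat \<Rightarrow> real \<Rightarrow> real \<Rightarrow> 'a tensor_series"
  assumes "p \<ge> 1"
    and "geometric_rough_path p T X" and "geometric_rough_path p T Y"
    and "signature_of p T X SX" and "signature_of p T Y SY"
    and "n \<ge> nat \<lfloor>p\<rfloor>"
    and "0 \<le> s" "s \<le> s'" "s' \<le> T" and "0 \<le> t" "t \<le> t'" "t' \<le> T"
    and "A \<in> E_space" and "B \<in> E_space"
    and x_def: "\<And>k. x k = tproj k (logn n (SX s s'))"
    and y_def: "\<And>k. y k = tproj k (logn n (SY t t'))"
    and "solves_log_ode Zx A (logn n (SX s s'))"
    and "solves_log_ode Zy B (logn n (SY t t'))"
    and f_def: "\<And>u v. f u v = tinner (Zx u) (Zy v)"
    and phi_def: "\<And>k u v. \<phi> k u v = (if k = 0 then 0 else tproj k (Ladj (Zx u) (Zy v)))"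
    and psi_def: "\<And>k u v. \<psi> k u v = (if k = 0 then 0 else tproj k (Ladj (Zy v) (Zx u)))"
    and alpha_def: "\<And>k. \<alpha> k = (\<Sum>m = 1..n - k. Radj (y m) (x (m + k)))"
    and beta_def: "\<And>k. \<beta> k = (\<Sum>m = 1..n - k. Radj (x m) (y (m + k)))"
    and gamma_def: "\<gamma> = (\<Sum>k = 1..n. hs_inner k (x k) (y k))"
  shows
    "(\<exists>f_v. \<forall>u\<in>{0..1}. \<forall>v\<in>{0..1}.
        ((\<lambda>v'. f u v') has_real_derivative f_v u v) (at v within {0..1}) \<and>
        ((\<lambda>u'. f_v u' v) has_real_derivative
           \<gamma> * f u v + (\<Sum>k = 0..n - 1. hs_inner k (\<alpha> k) (\<phi> k u v))
                     + (\<Sum>k = 0..n - 1. hs_inner k (\<beta> k) (\<psi> k u v))) (at u within {0..1})) \<and>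
     (\<forall>u\<in>{0..1}. \<forall>v\<in>{0..1}. \<forall>k\<in>{1..n - 1}.
        has_E_derivative (\<lambda>v'. \<phi> k u v')
          (f u v *\<^sub>R y k + (\<Sum>m = 0..k. \<phi> m u v * y (k - m))
             + (\<Sum>m = 0..n - k. Ladj (\<psi> m u v) (y (k + m)))) v \<and>
        has_E_derivative (\<lambda>u'. \<psi> k u' v)
          (f u v *\<^sub>R x k + (\<Sum>m = 0..k. \<psi> m u v * x (k - m))
             + (\<Sum>m = 0..n - k. Ladj (\<phi> m u v) (x (k + m)))) u) \<and>
     (\<forall>v\<in>{0..1}. f 0 v = tinner A (Zy v) \<and>
        (\<forall>k\<in>{1..n - 1}. \<psi> k 0 v = tproj k (Ladj (Zy v) A) \<and>
                        \<phi> k 0 v = tproj k (Ladj A (Zy v)))) \<and>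
     (\<forall>u\<in>{0..1}. f u 0 = tinner (Zx u) B \<and>
        (\<forall>k\<in>{1..n - 1}. \<phi> k u 0 = tproj k (Ladj (Zx u) B) \<and>
                        \<psi> k u 0 = tproj k (Ladj B (Zx u))))"
proof -
  let ?X = "logn n (SX s s')" and ?Y = "logn n (SY t t')"
  have solx: "Zx 0 = A" "\<And>u. u \<in> {0..1} \<Longrightarrow> Zx u \<in> E_space"
      "\<And>u. u \<in> {0..1} \<Longrightarrow> has_E_derivative Zx (Zx u * ?X) u"
    using \<open>solves_log_ode Zx A ?X\<close> by (auto simp: solves_log_ode_def)
  have soly: "Zy 0 = B" "\<And>v. v \<in> {0..1} \<Longrightarrow> Zy v \<in> E_space"
      "\<And>v. v \<in> {0..1} \<Longrightarrow> has_E_derivative Zy (Zy v * ?Y) v"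
    using \<open>solves_log_ode Zy B ?Y\<close> by (auto simp: solves_log_ode_def)
  have hx: "tproj k (x k) = x k" and hy: "tproj k (y k) = y k" for k
    by (simp_all add: x_def y_def)
  note X = logn_eq_sum[OF x_def] and Y = logn_eq_sum[OF y_def]
  \<comment> \<open>The mixed derivative is expanded over positive degrees, as in \<gamma>, \<alpha>
    and \<beta>; the first-order equations keep degree 0, as their sums over m = 0..k contain y 0 or
    x 0.\<close>
  have "{..n} = insert 0 {1..n}" by auto
  then have X1: "?X = (\<Sum>k = 1..n. x k)" and Y1: "?Y = (\<Sum>k = 1..n. y k)"
    using X Y by simp_all
  have XE: "?X \<in> E_space" and YE: "?Y \<in> E_space"
    by (simp_all add: logn_def E_space_ttrunc)
  note DX = E_space_mult[OF solx(2) XE] and DY = E_space_mult[OF soly(2) YE]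
  have f_v: "((\<lambda>v'. f u v') has_real_derivative tinner (Zx u) (Zy v * ?Y)) (at v within {0..1})"
    if "u \<in> {0..1}" "v \<in> {0..1}" for u v
    using tinner_has_real_derivative[OF soly(2) DY[OF that(2)] solx(2)[OF that(1)] soly(3)[OF that(2)] that(2)]
    by (simp add: f_def tinner_commute)
  have bulk: "(\<Sum>k = 1..n - 1. h k) = (\<Sum>k = 0..n - 1. h k)" if "h 0 = 0" for h :: "nat \<Rightarrow> real"
    using that by (intro sum.mono_neutral_left) (auto simp: not_less_eq_eq)
  \<comment> \<open>For fixed v the first derivative is again a pairing of \<open>Zx u\<close> with
    a fixed element of E, so the same differentiation lemma applies in u.\<close>
  have f_vu: "((\<lambda>u'. tinner (Zx u') (Zy v * ?Y)) has_real_derivative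
      \<gamma> * f u v + (\<Sum>k = 0..n - 1. hs_inner k (\<alpha> k) (\<phi> k u v))
        + (\<Sum>k = 0..n - 1. hs_inner k (\<beta> k) (\<psi> k u v))) (at u within {0..1})"
    if "u \<in> {0..1}" "v \<in> {0..1}" for u v
  proof -
    have "tinner (Zx u * ?X) (Zy v * ?Y) = \<gamma> * f u v
        + (\<Sum>k = 1..n - 1. hs_inner k (\<alpha> k) (tproj k (Ladj (Zx u) (Zy v))))
        + (\<Sum>k = 1..n - 1. hs_inner k (\<beta> k) (tproj k (Ladj (Zy v) (Zx u))))"
      unfolding X1 Y1 tinner_mult_mult_expand[OF soly(2)[OF that(2)] solx(2)[OF that(1)] hx hy]
      by (simp add: gamma_def f_def alpha_def beta_def)
    also have "\<dots> = \<gamma> * f u v + (\<Sum>k = 1..n - 1. hs_inner k (\<alpha> k) (\<phi> k u v))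
        + (\<Sum>k = 1..n - 1. hs_inner k (\<beta> k) (\<psi> k u v))"
      by (simp add: phi_def psi_def)
    also have "\<dots> = \<gamma> * f u v + (\<Sum>k = 0..n - 1. hs_inner k (\<alpha> k) (\<phi> k u v))
        + (\<Sum>k = 0..n - 1. hs_inner k (\<beta> k) (\<psi> k u v))"
      by (subst (1 2) bulk) (simp_all add: phi_def psi_def)
    finally show ?thesis
      using tinner_has_real_derivative[OF solx(2) DX[OF that(1)] DY[OF that(2)] solx(3)[OF that(1)] that(1)]
      by simp
  qed
  have phi_v: "has_E_derivative (\<lambda>v'. \<phi> k u v')
      (f u v *\<^sub>R y k + (\<Sum>m = 0..k. \<phi> m u v * y (k - m))
        + (\<Sum>m = 0..n - k. Ladj (\<psi> m u v) (y (k + m)))) v"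
    if "u \<in> {0..1}" "v \<in> {0..1}" "k \<in> {1..n - 1}" for u v k
  proof -
    have k: "k \<le> n" "k \<noteq> 0" using that by auto
    have "tproj k (Ladj (Zx u) (Zy v * ?Y)) = f u v *\<^sub>R y k + (\<Sum>m = 0..k. \<phi> m u v * y (k - m))
        + (\<Sum>m = 0..n - k. Ladj (\<psi> m u v) (y (k + m)))"
      unfolding Y(1) f_def
      by (rule tproj_Ladj_mult_expand[OF solx(2)[OF that(1)] soly(2)[OF that(2)] hy k(1) phi_def psi_def])
    then show ?thesis
      using Ladj_has_E_derivative[OF soly(2) DY[OF that(2)] solx(2)[OF that(1)] soly(3)[OF that(2)] that(2), of k]
        k(2) by (simp add: phi_def[of k])
  qed
  have psi_u: "has_E_derivative (\<lambda>u'. \<psi> k u' v)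
      (f u v *\<^sub>R x k + (\<Sum>m = 0..k. \<psi> m u v * x (k - m))
        + (\<Sum>m = 0..n - k. Ladj (\<phi> m u v) (x (k + m)))) u"
    if "u \<in> {0..1}" "v \<in> {0..1}" "k \<in> {1..n - 1}" for u v k
  proof -
    have k: "k \<le> n" "k \<noteq> 0" using that by auto
    \<comment> \<open>Same expansion with the two solutions exchanged; symmetry of
      \<open>tinner\<close> turns its scalar factor back into f.\<close>
    have "tproj k (Ladj (Zy v) (Zx u * ?X)) = f u v *\<^sub>R x k + (\<Sum>m = 0..k. \<psi> m u v * x (k - m))
        + (\<Sum>m = 0..n - k. Ladj (\<phi> m u v) (x (k + m)))"
      unfolding X(1) f_def tinner_commute[of "Zx u"]
      by (rule tproj_Ladj_mult_expand[OF soly(2)[OF that(2)] solx(2)[OF that(1)] hx k(1) psi_def phi_def])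
    then show ?thesis
      using Ladj_has_E_derivative[OF solx(2) DX[OF that(1)] soly(2)[OF that(2)] solx(3)[OF that(1)] that(1), of k]
        k(2) by (simp add: psi_def[of k])
  qed
  show ?thesis
  proof (intro conjI exI[of _ "\<lambda>u v. tinner (Zx u) (Zy v * ?Y)"] ballI)
  qed (use f_v f_vu phi_v psi_u in \<open>auto simp: f_def phi_def psi_def solx(1) soly(1)\<close>)
qed

end
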